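(* Let $(M,g,\xi,\lambda)$ be a connected Yamabe soliton of positive scalar curvature $R>0$. If the soliton field $\xi$ is a $\varphi$-analytic vector field and its length satisfies $\|\xi\|=\sqrt{2R}$ on $M$, then $g$ is a Yamabe metric, i.e. $R$ is constant on $M$.
   Context: A Yamabe soliton $(M,g,\xi,\lambda)$ is a connected smooth Riemannian manifold $(M,g)$ together with a smooth vector field $\xi$ (the soliton field) and a constant $\lambda\in\mathbb{R}$ such that $\frac12\mathcal{L}_\xi g=(R-\lambda)g$, where $\mathcal{L}_\xi$ is the Lie derivative and $R$ is the scalar curvature of $g$. No compactness or completeness is assumed. The metric $g$ is called a Yamabe metric if $R$ is constant. Let $\eta$ be the $1$-form dual to $\xi$, $\eta(X)=g(X,\xi)$, and let $\varphi$ be the skew-symmetric $(1,1)$-tensor field defined by $\frac12 d\eta(X,Y)=g(\varphi X,Y)$, where $d\eta(X,Y)=X(\eta(Y))-Y(\eta(X))-\eta([X,Y])$; with $\nabla$ the Levi-Civita connection one then has $\nabla_X\xi=(R-\lambda)X+\varphi X$. The soliton field $\xi$ is called $\varphi$-analytic if $\varphi$ is invariant under the local flow of $\xi$, i.e. $\mathcal{L}_\xi\varphi=0$. *)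

theory Defs
  imports "HOL-Analysis.Analysis"
begin

section \<open>Smooth manifolds\<close>

text \<open>
  Smoothness on an open set \<open>S\<close> of a normed space, through iterated directional derivatives;
  on finite-dimensional spaces this is the usual notion of \<open>C\<^sup>k\<close> map.
\<close>

primrec Ck_on :: "nat \<Rightarrow> 'a::real_normed_vector set \<Rightarrow> ('a \<Rightarrow> 'b::real_normed_vector) \<Rightarrow> bool" where
  "Ck_on 0 S f \<longleftrightarrow> continuous_on S f"
| "Ck_on (Suc k) S f \<longleftrightarrow> (\<forall>x\<in>S. f differentiable (at x)) \<and>
     (\<forall>v. Ck_on k S (\<lambda>x. frechet_derivative f (at x) v))"

definition smooth_on :: "'a::real_normed_vector set \<Rightarrow> ('a \<Rightarrow> 'b::real_normed_vector) \<Rightarrow> bool" where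
  "smooth_on S f \<longleftrightarrow> (\<forall>k. Ck_on k S f)"

text \<open>
  The manifold is the whole type \<open>'m\<close>; its dimension is \<open>CARD('n)\<close>.  A chart is a pair of its
  domain and its coordinate map.  Atlases are not required to be maximal: all notions below depend
  only on the smooth structure that the atlas generates.
\<close>

type_synonym ('m, 'n) chart = "'m set \<times> ('m \<Rightarrow> real ^ 'n)"

definition smooth_atlas ::
  "('m::{t2_space,second_countable_topology}, 'n::finite) chart set \<Rightarrow> bool" where
  "smooth_atlas A \<longleftrightarrow>
     (\<forall>(U, c)\<in>A. open U \<and> open (c ` U) \<and> homeomorphism U (c ` U) c (inv_into U c)) \<and>
     (\<Union>(U, c)\<in>A. U) = UNIV \<and>
     (\<forall>(U, c)\<in>A. \<forall>(V, d)\<in>A. smooth_on (c ` (U \<inter> V)) (d \<circ> inv_into U c))"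

definition smooth_fun ::
  "('m::topological_space, 'n::finite) chart set \<Rightarrow> 'm set \<Rightarrow> ('m \<Rightarrow> real) \<Rightarrow> bool" where
  "smooth_fun A W f \<longleftrightarrow> (\<forall>(U, c)\<in>A. smooth_on (c ` (U \<inter> W)) (f \<circ> inv_into U c))"

definition smooth_near ::
  "('m::topological_space, 'n::finite) chart set \<Rightarrow> 'm \<Rightarrow> ('m \<Rightarrow> real) \<Rightarrow> bool" where
  "smooth_near A p f \<longleftrightarrow> (\<exists>W. open W \<and> p \<in> W \<and> smooth_fun A W f)"


section \<open>Tangent vectors and vector fields\<close>

text \<open>
  A tangent vector at \<open>p\<close> is a directional derivative \<open>f \<mapsto> D(f \<circ> c\<^sup>-\<^sup>1)(c p) v\<close> of the functions
  \<open>f\<close> that are smooth near \<open>p\<close>.  Its value at all other \<open>f\<close> is fixed to be 0, so that tangent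
  vectors are determined by their action on smooth germs.
\<close>

type_synonym 'm tangent = "('m \<Rightarrow> real) \<Rightarrow> real"
type_synonym 'm field = "'m \<Rightarrow> 'm tangent"

definition chart_vector ::
  "('m::topological_space, 'n::finite) chart set \<Rightarrow> ('m, 'n) chart \<Rightarrow> 'm \<Rightarrow> real ^ 'n \<Rightarrow> 'm tangent" where
  "chart_vector A = (\<lambda>(U, c) p v f.
     if smooth_near A p f then frechet_derivative (f \<circ> inv_into U c) (at (c p)) v else 0)"

definition tangent_space ::
  "('m::topological_space, 'n::finite) chart set \<Rightarrow> 'm \<Rightarrow> 'm tangent set" where
  "tangent_space A p = {chart_vector A (U, c) p v | U c v. (U, c) \<in> A \<and> p \<in> U}"

definition vector_field ::
  "('m::topological_space, 'n::finite) chart set \<Rightarrow> 'm set \<Rightarrow> 'm field \<Rightarrow> bool" where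
  "vector_field A W X \<longleftrightarrow>
     (\<forall>p\<in>W. X p \<in> tangent_space A p) \<and>
     (\<forall>W' f. open W' \<and> W' \<subseteq> W \<and> smooth_fun A W' f \<longrightarrow> smooth_fun A W' (\<lambda>p. X p f))"

definition lie_bracket ::
  "('m::topological_space, 'n::finite) chart set \<Rightarrow> 'm field \<Rightarrow> 'm field \<Rightarrow> 'm field" where
  "lie_bracket A X Y p f =
     (if smooth_near A p f then X p (\<lambda>q. Y q f) - Y p (\<lambda>q. X q f) else 0)"


section \<open>Riemannian metrics, the Levi-Civita connection and scalar curvature\<close>

text \<open>
  Identities between tensor fields are tested on vector fields that are defined on an arbitrary
  open set \<open>W\<close>, and not only on globally defined ones.
\<close>

definition riemannian_metric ::
  "('m::topological_space, 'n::finite) chart set \<Rightarrow> ('m \<Rightarrow> 'm tangent \<Rightarrow> 'm tangent \<Rightarrow> real) \<Rightarrow> bool" where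
  "riemannian_metric A g \<longleftrightarrow>
     (\<forall>p. \<forall>u\<in>tangent_space A p. \<forall>v\<in>tangent_space A p. \<forall>w\<in>tangent_space A p. \<forall>a.
        g p u v = g p v u \<and>
        g p (\<lambda>f. a * u f + v f) w = a * g p u w + g p v w) \<and>
     (\<forall>p. \<forall>u\<in>tangent_space A p. u \<noteq> (\<lambda>f. 0) \<longrightarrow> g p u u > 0) \<and>
     (\<forall>W X Y. open W \<and> vector_field A W X \<and> vector_field A W Y \<longrightarrow>
        smooth_fun A W (\<lambda>p. g p (X p) (Y p)))"

text \<open>
  Affine connection (first three identities), without torsion, compatible with \<open>g\<close>.  By the
  fundamental theorem of Riemannian geometry such a \<open>D\<close> exists, and \<open>D X Y\<close> is unique on
  every open set on which \<open>X\<close> and \<open>Y\<close> are smooth vector fields.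
\<close>

definition levi_civita ::
  "('m::topological_space, 'n::finite) chart set \<Rightarrow> ('m \<Rightarrow> 'm tangent \<Rightarrow> 'm tangent \<Rightarrow> real) \<Rightarrow>
   ('m field \<Rightarrow> 'm field \<Rightarrow> 'm field) \<Rightarrow> bool" where
  "levi_civita A g D \<longleftrightarrow>
     (\<forall>W X Y Z h. open W \<and> vector_field A W X \<and> vector_field A W Y \<and> vector_field A W Z \<and>
        smooth_fun A W h \<longrightarrow>
        vector_field A W (D X Y) \<and>
        (\<forall>p\<in>W.
          D (\<lambda>q f. h q * X q f + Y q f) Z p = (\<lambda>f. h p * D X Z p f + D Y Z p f) \<and>
          D X (\<lambda>q f. Y q f + Z q f) p = (\<lambda>f. D X Y p f + D X Z p f) \<and>
          D X (\<lambda>q f. h q * Y q f) p = (\<lambda>f. X p h * Y p f + h p * D X Y p f) \<and>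
          (\<lambda>f. D X Y p f - D Y X p f) = lie_bracket A X Y p \<and>
          X p (\<lambda>q. g q (Y q) (Z q)) = g p (D X Y p) (Z p) + g p (Y p) (D X Z p)))"

definition curvature ::
  "('m::topological_space, 'n::finite) chart set \<Rightarrow> ('m field \<Rightarrow> 'm field \<Rightarrow> 'm field) \<Rightarrow>
   'm field \<Rightarrow> 'm field \<Rightarrow> 'm field \<Rightarrow> 'm field" where
  "curvature A D X Y Z p f =
     D X (D Y Z) p f - D Y (D X Z) p f - D (lie_bracket A X Y) Z p f"

text \<open>
  Trace of the Ricci tensor \<open>Ric(Y, Z) = tr (X \<mapsto> Rm(X, Y) Z)\<close>, computed on any smooth local
  vector fields that are orthonormal at \<open>p\<close>; the sum does not depend on their choice
  and is positive on round spheres of dimension at least 2.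
\<close>

definition scalar_curvature ::
  "('m::topological_space, 'n::finite) chart set \<Rightarrow> ('m \<Rightarrow> 'm tangent \<Rightarrow> 'm tangent \<Rightarrow> real) \<Rightarrow>
   ('m field \<Rightarrow> 'm field \<Rightarrow> 'm field) \<Rightarrow> 'm \<Rightarrow> real" where
  "scalar_curvature A g D p =
     (THE r. \<exists>W (E :: 'n \<Rightarrow> 'm field).
        open W \<and> p \<in> W \<and> (\<forall>i. vector_field A W (E i)) \<and>
        (\<forall>i j. g p (E i p) (E j p) = (if i = j then 1 else 0)) \<and>
        r = (\<Sum>j\<in>UNIV. \<Sum>i\<in>UNIV. g p (curvature A D (E i) (E j) (E j) p) (E i p)))"

definition yamabe_metric ::
  "('m::topological_space, 'n::finite) chart set \<Rightarrow> ('m \<Rightarrow> 'm tangent \<Rightarrow> 'm tangent \<Rightarrow> real) \<Rightarrow>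
   ('m field \<Rightarrow> 'm field \<Rightarrow> 'm field) \<Rightarrow> bool" where
  "yamabe_metric A g D \<longleftrightarrow> (\<exists>r. \<forall>p. scalar_curvature A g D p = r)"


section \<open>Yamabe solitons\<close>

definition lie_derivative_metric ::
  "('m::topological_space, 'n::finite) chart set \<Rightarrow> 'm field \<Rightarrow>
   ('m \<Rightarrow> 'm tangent \<Rightarrow> 'm tangent \<Rightarrow> real) \<Rightarrow> 'm field \<Rightarrow> 'm field \<Rightarrow> 'm \<Rightarrow> real" where
  "lie_derivative_metric A \<xi> g X Y p =
     \<xi> p (\<lambda>q. g q (X q) (Y q)) - g p (lie_bracket A \<xi> X p) (Y p) - g p (X p) (lie_bracket A \<xi> Y p)"

definition yamabe_soliton ::
  "('m::{t2_space,second_countable_topology}, 'n::finite) chart set \<Rightarrow>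
   ('m \<Rightarrow> 'm tangent \<Rightarrow> 'm tangent \<Rightarrow> real) \<Rightarrow> ('m field \<Rightarrow> 'm field \<Rightarrow> 'm field) \<Rightarrow>
   'm field \<Rightarrow> real \<Rightarrow> bool" where
  "yamabe_soliton A g D \<xi> l \<longleftrightarrow>
     connected (UNIV :: 'm set) \<and> smooth_atlas A \<and> riemannian_metric A g \<and> levi_civita A g D \<and>
     vector_field A UNIV \<xi> \<and>
     (\<forall>W X Y. open W \<and> vector_field A W X \<and> vector_field A W Y \<longrightarrow>
        (\<forall>p\<in>W. 1 / 2 * lie_derivative_metric A \<xi> g X Y p =
                (scalar_curvature A g D p - l) * g p (X p) (Y p)))"

definition dual_form ::
  "('m \<Rightarrow> 'm tangent \<Rightarrow> 'm tangent \<Rightarrow> real) \<Rightarrow> 'm field \<Rightarrow> 'm field \<Rightarrow> 'm \<Rightarrow> real" where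
  "dual_form g \<xi> X p = g p (X p) (\<xi> p)"

definition exterior_derivative ::
  "('m::topological_space, 'n::finite) chart set \<Rightarrow> ('m field \<Rightarrow> 'm \<Rightarrow> real) \<Rightarrow>
   'm field \<Rightarrow> 'm field \<Rightarrow> 'm \<Rightarrow> real" where
  "exterior_derivative A \<eta> X Y p = X p (\<eta> Y) - Y p (\<eta> X) - \<eta> (lie_bracket A X Y) p"

definition tensor_field_11 ::
  "('m::topological_space, 'n::finite) chart set \<Rightarrow> ('m \<Rightarrow> 'm tangent \<Rightarrow> 'm tangent) \<Rightarrow> bool" where
  "tensor_field_11 A \<phi> \<longleftrightarrow>
     (\<forall>p. \<forall>u\<in>tangent_space A p. \<forall>v\<in>tangent_space A p. \<forall>a.
        \<phi> p u \<in> tangent_space A p \<and>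
        \<phi> p (\<lambda>f. a * u f + v f) = (\<lambda>f. a * \<phi> p u f + \<phi> p v f)) \<and>
     (\<forall>W X. open W \<and> vector_field A W X \<longrightarrow> vector_field A W (\<lambda>p. \<phi> p (X p)))"

text \<open>
  The defining property of \<open>\<phi>\<close>: skew-symmetric with \<open>1/2 d\<eta>(X, Y) = g(\<phi> X, Y)\<close>.  It determines
  \<open>\<phi> p\<close> on the tangent space at \<open>p\<close>.
\<close>

definition associated_tensor ::
  "('m::topological_space, 'n::finite) chart set \<Rightarrow> ('m \<Rightarrow> 'm tangent \<Rightarrow> 'm tangent \<Rightarrow> real) \<Rightarrow>
   'm field \<Rightarrow> ('m \<Rightarrow> 'm tangent \<Rightarrow> 'm tangent) \<Rightarrow> bool" where
  "associated_tensor A g \<xi> \<phi> \<longleftrightarrow>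
     tensor_field_11 A \<phi> \<and>
     (\<forall>p. \<forall>u\<in>tangent_space A p. \<forall>v\<in>tangent_space A p. g p (\<phi> p u) v = - g p u (\<phi> p v)) \<and>
     (\<forall>W X Y. open W \<and> vector_field A W X \<and> vector_field A W Y \<longrightarrow>
        (\<forall>p\<in>W. 1 / 2 * exterior_derivative A (dual_form g \<xi>) X Y p = g p (\<phi> p (X p)) (Y p)))"

definition lie_derivative_11 ::
  "('m::topological_space, 'n::finite) chart set \<Rightarrow> 'm field \<Rightarrow>
   ('m \<Rightarrow> 'm tangent \<Rightarrow> 'm tangent) \<Rightarrow> 'm field \<Rightarrow> 'm field" where
  "lie_derivative_11 A \<xi> \<phi> X p f =
     lie_bracket A \<xi> (\<lambda>q. \<phi> q (X q)) p f - \<phi> p (lie_bracket A \<xi> X p) f"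

definition phi_analytic ::
  "('m::topological_space, 'n::finite) chart set \<Rightarrow> 'm field \<Rightarrow>
   ('m \<Rightarrow> 'm tangent \<Rightarrow> 'm tangent) \<Rightarrow> bool" where
  "phi_analytic A \<xi> \<phi> \<longleftrightarrow>
     (\<forall>W X. open W \<and> vector_field A W X \<longrightarrow>
        (\<forall>p\<in>W. lie_derivative_11 A \<xi> \<phi> X p = (\<lambda>f. 0)))"

end

theory Submission
  imports Defs
begin

text \<open>
  Write \<open>\<rho> = R - \<lambda>\<close> with \<open>\<lambda>\<close> the soliton constant, \<open>\<eta>\<close> for the form dual to \<open>\<xi>\<close> and \<open>n\<close> for the
  dimension.  The proof shows that \<open>\<rho>\<close> vanishes identically, so that \<open>R\<close> is the constant \<open>\<lambda>\<close>.

  The soliton equation gives \<open>L\<^sub>\<xi> \<eta> = 2 \<rho> \<eta>\<close>, hence \<open>L\<^sub>\<xi> d\<eta> = 2 d\<rho> \<and> \<eta> + 2 \<rho> d\<eta>\<close>.  On the other hand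
  \<open>d\<eta> = 2 g(\<phi> \<sqdot>, \<sqdot>)\<close>, so invariance of \<open>\<phi>\<close> gives \<open>L\<^sub>\<xi> d\<eta> = 2 \<rho> d\<eta>\<close>.  Therefore \<open>d\<rho> \<and> \<eta> = 0\<close>
  (\<open>d_rho_wedge_eta\<close>).  Because \<open>|\<xi>|\<^sup>2 = 2R\<close>, the equation \<open>\<xi>(\<eta>(\<xi>)) = 2 \<rho> \<eta>(\<xi>)\<close> reads
  \<open>\<xi> \<rho> = \<rho> |\<xi>|\<^sup>2\<close>; as \<open>R > 0\<close> the field \<open>\<xi>\<close> has no zeros, and the two facts combine to \<open>d\<rho> = \<rho> \<eta>\<close>
  (\<open>d_rho\<close>).  Applying \<open>d\<close> once more yields \<open>\<rho> d\<eta> = 0\<close> (\<open>rho_Phi\<close>).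

  Suppose that \<open>\<rho>\<close> is nonzero at some point.  Near it \<open>\<phi> = 0\<close> and \<open>\<nabla>\<^sub>X \<xi> = \<rho> X\<close> (\<open>D_xi\<close>), which determines
  all components of the curvature tensor with an entry \<open>\<xi>\<close>:
  \<open>Rm(\<xi>, X) Y = \<rho> (\<eta>(Y) X - g(X, Y) \<xi>)\<close> (\<open>g_Rm_xi\<close>).  By the second Bianchi identity these components
  control the derivative of the whole curvature tensor along \<open>\<xi>\<close> (\<open>xi_Rm\<close>), and tracing in an
  orthonormal frame gives \<open>\<xi> R = - 2 \<rho> R - 2 (n - 1) \<rho> |\<xi>|\<^sup>2 - 2 n (n - 1) \<rho>\<^sup>2\<close>.  Comparing with
  \<open>\<xi> R = \<rho> |\<xi>|\<^sup>2 = 2 \<rho> R\<close> leaves the linear relation \<open>2 R = (1 - n) \<rho>\<close> between \<open>R\<close> and \<open>R - \<lambda>\<close>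
  (\<open>scalar_identity\<close>).  It forces \<open>R\<close> to be constant near the point, so \<open>2 \<rho> R = \<xi> R = 0\<close>, which
  contradicts \<open>\<rho> \<noteq> 0\<close> and \<open>R > 0\<close>.

  Two preparations carry this computation.  The tangent space at a point is parametrised linearly by
  any one chart, and Gram--Schmidt applied to coordinate fields produces a smooth orthonormal frame on
  each chart domain (\<open>orthonormal_frame_exists\<close>).  The curvature is linear over functions in
  every argument, so the trace that defines \<open>R\<close> may be taken in that one frame at all points of its
  domain (\<open>scalar_curvature_frame\<close>), and \<open>R\<close> can be differentiated.
\<close>

section \<open>Calculus of \<open>C\<^sup>k\<close> functions\<close>

lemma Ck_on_cong:
  assumes "open S" "\<And>x. x \<in> S \<Longrightarrow> f x = h x" "Ck_on k S f"
  shows "Ck_on k S h"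
  using assms(2,3)
proof (induction k arbitrary: f h)
  case 0
  then show ?case by (metis Ck_on.simps(1) continuous_on_cong)
next
  case (Suc k)
  have d: "frechet_derivative f (at x) = frechet_derivative h (at x)" "h differentiable at x"
    if "x \<in> S" for x
  proof -
    have "(f has_derivative frechet_derivative f (at x)) (at x)"
      using Suc.prems(2) that by (simp add: frechet_derivative_works)
    then have "(h has_derivative frechet_derivative f (at x)) (at x)"
      by (rule has_derivative_transform_within_open[OF _ assms(1) that]) (rule Suc.prems(1))
    then show "frechet_derivative f (at x) = frechet_derivative h (at x)" "h differentiable at x"
      by (auto simp: frechet_derivative_at differentiable_def)
  qed
  show ?case
    using Suc.prems(2) d Suc.IH[of "\<lambda>x. frechet_derivative f (at x) v" "\<lambda>x. frechet_derivative h (at x) v" for v]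
    by auto
qed

lemma Ck_on_subset: "Ck_on k S f \<Longrightarrow> T \<subseteq> S \<Longrightarrow> Ck_on k T f"
  by (induction k arbitrary: f) (auto intro: continuous_on_subset)

lemma Ck_on_Suc_imp: "Ck_on (Suc k) S f \<Longrightarrow> Ck_on k S f"
proof (induction k arbitrary: f)
  case 0
  then show ?case
    by (auto intro!: continuous_at_imp_continuous_on differentiable_imp_continuous_within)
next
  case (Suc k)
  then show ?case by (metis Ck_on.simps(2))
qed

lemma Ck_on_const: "Ck_on k S (\<lambda>x. b)"
  by (induction k arbitrary: b) auto

lemma Ck_on_add:
  assumes "open S"
  shows "Ck_on k S f \<Longrightarrow> Ck_on k S h \<Longrightarrow> Ck_on k S (\<lambda>x. f x + h x)"
proof (induction k arbitrary: f h)
  case 0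
  then show ?case by (simp add: continuous_on_add)
next
  case (Suc k)
  have 1: "((\<lambda>x. f x + h x) has_derivative
      (\<lambda>v. frechet_derivative f (at x) v + frechet_derivative h (at x) v)) (at x)" if "x \<in> S" for x
    using Suc.prems that frechet_derivative_works
    by (intro has_derivative_add) auto
  have "Ck_on k S (\<lambda>x. frechet_derivative (\<lambda>x. f x + h x) (at x) v)" for v
    by (rule Ck_on_cong[OF assms(1) _ Suc.IH[of "\<lambda>x. frechet_derivative f (at x) v"
          "\<lambda>x. frechet_derivative h (at x) v"]])
      (use Suc.prems frechet_derivative_at[OF 1] in \<open>auto dest: fun_cong\<close>)
  then show ?case using 1 by (auto simp: differentiable_def)
qed

lemma Ck_on_bounded_linear:
  assumes "open S" "bounded_linear L"
  shows "Ck_on k S f \<Longrightarrow> Ck_on k S (\<lambda>x. L (f x))"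
proof (induction k arbitrary: f)
  case 0
  then show ?case using assms by (simp add: bounded_linear.continuous_on)
next
  case (Suc k)
  have 1: "((\<lambda>x. L (f x)) has_derivative (\<lambda>v. L (frechet_derivative f (at x) v))) (at x)" if "x \<in> S" for x
    using Suc.prems that frechet_derivative_works
    by (intro bounded_linear.has_derivative[OF assms(2)]) auto
  have "Ck_on k S (\<lambda>x. frechet_derivative (\<lambda>x. L (f x)) (at x) v)" for v
    by (rule Ck_on_cong[OF assms(1) _ Suc.IH[of "\<lambda>x. frechet_derivative f (at x) v"]])
      (use Suc.prems frechet_derivative_at[OF 1] in \<open>auto dest: fun_cong\<close>)
  then show ?case using 1 by (auto simp: differentiable_def)
qed

lemma Ck_on_mult:
  fixes f h :: "'a::real_normed_vector \<Rightarrow> real"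
  assumes "open S"
  shows "Ck_on k S f \<Longrightarrow> Ck_on k S h \<Longrightarrow> Ck_on k S (\<lambda>x. f x * h x)"
proof (induction k arbitrary: f h)
  case 0
  then show ?case by (simp add: continuous_on_mult)
next
  case (Suc k)
  have 1: "((\<lambda>x. f x * h x) has_derivative
      (\<lambda>v. f x * frechet_derivative h (at x) v + frechet_derivative f (at x) v * h x)) (at x)"
    if "x \<in> S" for x
    using Suc.prems that frechet_derivative_works
    by (intro has_derivative_mult) auto
  have "Ck_on k S (\<lambda>x. f x * frechet_derivative h (at x) v + frechet_derivative f (at x) v * h x)" for v
    using Suc.prems Ck_on_Suc_imp by (intro Ck_on_add assms Suc.IH) auto
  then have "Ck_on k S (\<lambda>x. frechet_derivative (\<lambda>x. f x * h x) (at x) v)" for v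
    by (rule Ck_on_cong[OF assms(1), rotated])
      (use frechet_derivative_at[OF 1] in \<open>auto dest: fun_cong\<close>)
  then show ?case using 1 by (auto simp: differentiable_def)
qed

lemma Ck_on_sum:
  assumes "open S" "\<And>i. i \<in> I \<Longrightarrow> Ck_on k S (f i)"
  shows "Ck_on k S (\<lambda>x. \<Sum>i\<in>I. f i x)"
  using assms(2)
proof (induction I rule: infinite_finite_induct)
  case (insert i I)
  then show ?case by (simp add: Ck_on_add[OF assms(1)])
qed (simp_all add: Ck_on_const)

text \<open>
  The derivative of \<open>u\<^sup>a\<close> is \<open>a u\<^sup>a\<^sup>-\<^sup>1 u'\<close>, again built from a real power, so one induction over all
  exponents at once covers the roots and reciprocals needed to normalise a vector field.
\<close>

lemma Ck_on_powr:
  fixes u :: "'a::real_normed_vector \<Rightarrow> real"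
  assumes "open S" and pos: "\<And>x. x \<in> S \<Longrightarrow> u x > 0"
  shows "Ck_on k S u \<Longrightarrow> Ck_on k S (\<lambda>x. u x powr a)"
proof (induction k arbitrary: a)
  case 0
  then have "continuous_on S (\<lambda>x. u x powr a)"
    by (intro continuous_on_powr continuous_on_const) (use pos in fastforce)+
  then show ?case by simp
next
  case (Suc k)
  have 1: "((\<lambda>x. u x powr a) has_derivative
      (\<lambda>v. (a * u x powr (a - 1)) * frechet_derivative u (at x) v)) (at x)" if "x \<in> S" for x
  proof -
    have "(u has_derivative frechet_derivative u (at x)) (at x)"
      using Suc.prems that by (simp add: frechet_derivative_works)
    moreover have "((\<lambda>y. y powr a) has_derivative (\<lambda>y. (a * u x powr (a - 1)) * y)) (at (u x))"
      using has_real_derivative_powr[OF pos[OF that], of a]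
      by (simp add: has_field_derivative_def)
    ultimately show ?thesis
      using diff_chain_at[of u _ x "\<lambda>y. y powr a"] by (simp add: o_def)
  qed
  have "Ck_on k S (\<lambda>x. (a * u x powr (a - 1)) * frechet_derivative u (at x) v)" for v
    using Suc.prems
    by (intro Ck_on_mult[OF assms(1)] Ck_on_mult[OF assms(1) Ck_on_const] Suc.IH Ck_on_Suc_imp[OF Suc.prems]) simp
  then have "Ck_on k S (\<lambda>x. frechet_derivative (\<lambda>x. u x powr a) (at x) v)" for v
    by (rule Ck_on_cong[OF assms(1), rotated])
      (use frechet_derivative_at[OF 1] in \<open>auto dest: fun_cong\<close>)
  then show ?case using 1 by (auto simp: differentiable_def)
qed

text \<open>
  Differentiability classes are defined through derivatives in fixed directions, but the chain rule
  differentiates \<open>h\<close> in the moving direction \<open>\<psi>'(x) v\<close>.  Expanding that direction in the standard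
  basis brings back directional derivatives of \<open>h\<close> in fixed directions.
\<close>

lemma Ck_on_compose:
  fixes h :: "'b::euclidean_space \<Rightarrow> real" and \<psi> :: "'a::real_normed_vector \<Rightarrow> 'b"
  assumes "open S" "\<psi> ` S \<subseteq> T"
  shows "Ck_on k T h \<Longrightarrow> Ck_on k S \<psi> \<Longrightarrow> Ck_on k S (\<lambda>x. h (\<psi> x))"
proof (induction k arbitrary: h)
  case 0
  then show ?case using assms by (auto intro: continuous_on_compose2)
next
  case (Suc k)
  have 1: "((\<lambda>x. h (\<psi> x)) has_derivative
      (\<lambda>v. \<Sum>b\<in>Basis. frechet_derivative h (at (\<psi> x)) b * (frechet_derivative \<psi> (at x) v \<bullet> b))) (at x)"
    if "x \<in> S" for x
  proof -
    have p: "(\<psi> has_derivative frechet_derivative \<psi> (at x)) (at x)"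
      using Suc.prems that by (simp add: frechet_derivative_works)
    have q: "(h has_derivative frechet_derivative h (at (\<psi> x))) (at (\<psi> x))"
      using Suc.prems that assms(2) by (auto simp: frechet_derivative_works)
    have lin: "linear (frechet_derivative h (at (\<psi> x)))"
      using q has_derivative_linear by blast
    have e: "frechet_derivative h (at (\<psi> x)) w
        = (\<Sum>b\<in>Basis. frechet_derivative h (at (\<psi> x)) b * (w \<bullet> b))" for w
      by (subst (1) euclidean_representation[of w, symmetric])
        (simp add: linear_sum[OF lin] linear_cmul[OF lin] mult.commute)
    show ?thesis
      using diff_chain_at[OF p q] unfolding o_def e[of "frechet_derivative \<psi> (at x) v" for v] .
  qed
  have "Ck_on k S (\<lambda>x. \<Sum>b\<in>Basis. frechet_derivative h (at (\<psi> x)) b * (frechet_derivative \<psi> (at x) v \<bullet> b))" for v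
    using Suc.prems Ck_on_Suc_imp
    by (intro Ck_on_sum Ck_on_mult assms Suc.IH[of "\<lambda>y. frechet_derivative h (at y) b" for b]
        Ck_on_bounded_linear[of S "\<lambda>x. x \<bullet> b" for b] bounded_linear_inner_left) auto
  then have "Ck_on k S (\<lambda>x. frechet_derivative (\<lambda>x. h (\<psi> x)) (at x) v)" for v
    by (rule Ck_on_cong[OF assms(1), rotated])
      (use frechet_derivative_at[OF 1] in \<open>auto dest: fun_cong\<close>)
  then show ?case using 1 by (auto simp: differentiable_def)
qed

lemma smooth_on_differentiable: "smooth_on S f \<Longrightarrow> x \<in> S \<Longrightarrow> f differentiable (at x)"
  unfolding smooth_on_def by (metis Ck_on.simps(2))

lemma smooth_on_frechet: "smooth_on S f \<Longrightarrow> smooth_on S (\<lambda>x. frechet_derivative f (at x) v)"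
  unfolding smooth_on_def by (metis Ck_on.simps(2))

section \<open>Tangent vectors and vector fields on a manifold\<close>

lemma smooth_on_cong:
  "open S \<Longrightarrow> (\<And>x. x \<in> S \<Longrightarrow> f x = h x) \<Longrightarrow> smooth_on S f \<Longrightarrow> smooth_on S h"
  unfolding smooth_on_def using Ck_on_cong by blast

locale smooth_manifold =
  fixes A :: "('m::{t2_space,second_countable_topology}, 'n::finite) chart set"
  assumes atlas: "smooth_atlas A"
begin

lemma chart_open: "(U, c) \<in> A \<Longrightarrow> open U"
  using atlas unfolding smooth_atlas_def by fast

lemma chart_inv: "(U, c) \<in> A \<Longrightarrow> p \<in> U \<Longrightarrow> inv_into U c (c p) = p"
  using atlas unfolding smooth_atlas_def homeomorphism_def by fast

lemma chart_image_open:
  assumes "(U, c) \<in> A" "open W"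
  shows "open (c ` (U \<inter> W))"
proof -
  have h: "homeomorphism U (c ` U) c (inv_into U c)" and o: "open (c ` U)"
    using atlas assms unfolding smooth_atlas_def by fast+
  have "openin (top_of_set (c ` U)) (c ` (U \<inter> W))"
    using homeomorphism_imp_open_map[OF h] assms(2) by (simp add: openin_open_Int)
  then show ?thesis using o openin_open_eq by blast
qed

lemma transition_smooth:
  assumes "(U, c) \<in> A" "(V, d) \<in> A"
  shows "smooth_on (c ` (U \<inter> V)) (d \<circ> inv_into U c)"
  using atlas assms unfolding smooth_atlas_def by fast

lemma chart_at: obtains U c where "(U, c) \<in> A" "p \<in> U"
proof -
  have "p \<in> (\<Union>(U, c)\<in>A. U)" using atlas unfolding smooth_atlas_def by simp
  then show ?thesis using that by auto
qed

lemma smooth_fun_subset: "smooth_fun A W f \<Longrightarrow> W' \<subseteq> W \<Longrightarrow> smooth_fun A W' f"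
  unfolding smooth_fun_def smooth_on_def
  by (auto elim!: ballE intro: Ck_on_subset[OF _ image_mono] dest!: spec)

lemma smooth_fun_cong:
  assumes "open W" "\<And>q. q \<in> W \<Longrightarrow> f q = h q" "smooth_fun A W f"
  shows "smooth_fun A W h"
  unfolding smooth_fun_def
proof safe
  fix U c assume c: "(U, c) \<in> A"
  then have "smooth_on (c ` (U \<inter> W)) (f \<circ> inv_into U c)"
    using assms(3) unfolding smooth_fun_def by auto
  then show "smooth_on (c ` (U \<inter> W)) (h \<circ> inv_into U c)"
    by (rule smooth_on_cong[OF chart_image_open[OF c assms(1)], rotated])
      (use assms(2) chart_inv[OF c] in auto)
qed

lemma smooth_fun_const: "smooth_fun A W (\<lambda>q. b)"
  unfolding smooth_fun_def smooth_on_def by (auto simp: o_def Ck_on_const)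

lemma smooth_fun_add:
  assumes "open W" "smooth_fun A W f" "smooth_fun A W h"
  shows "smooth_fun A W (\<lambda>q. f q + h q)"
  using assms chart_image_open[OF _ assms(1)]
  unfolding smooth_fun_def smooth_on_def o_def by (fast intro: Ck_on_add)

lemma smooth_fun_mult:
  assumes "open W" "smooth_fun A W f" "smooth_fun A W h"
  shows "smooth_fun A W (\<lambda>q. f q * h q)"
  using assms chart_image_open[OF _ assms(1)]
  unfolding smooth_fun_def smooth_on_def o_def by (fast intro: Ck_on_mult)

lemma smooth_fun_minus:
  assumes "open W" "smooth_fun A W f"
  shows "smooth_fun A W (\<lambda>q. - f q)"
  using smooth_fun_mult[OF assms(1) smooth_fun_const[of W "-1"] assms(2)] by simp

lemma smooth_fun_diff:
  assumes "open W" "smooth_fun A W f" "smooth_fun A W h"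
  shows "smooth_fun A W (\<lambda>q. f q - h q)"
  using smooth_fun_add[OF assms(1,2) smooth_fun_minus[OF assms(1,3)]] by simp

lemma smooth_fun_powr:
  assumes "open W" "smooth_fun A W f" "\<And>q. q \<in> W \<Longrightarrow> f q > 0"
  shows "smooth_fun A W (\<lambda>q. f q powr a)"
  unfolding smooth_fun_def smooth_on_def o_def
proof (safe)
  fix U c k assume c: "(U, c) \<in> A"
  then have "Ck_on k (c ` (U \<inter> W)) (\<lambda>x. f (inv_into U c x))"
    using assms(2) unfolding smooth_fun_def smooth_on_def o_def by auto
  then show "Ck_on k (c ` (U \<inter> W)) (\<lambda>x. f (inv_into U c x) powr a)"
    by (rule Ck_on_powr[OF chart_image_open[OF c assms(1)], rotated])
      (use assms(3) chart_inv[OF c] in auto)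
qed

text \<open>
  Inside a chart domain, smoothness in that one chart suffices: every other chart differs from it by a
  smooth transition map.
\<close>

lemma smooth_fun_chartI:
  assumes c: "(U, c) \<in> A" and W: "open W" "W \<subseteq> U" and f: "smooth_on (c ` W) (f \<circ> inv_into U c)"
  shows "smooth_fun A W f"
  unfolding smooth_fun_def
proof safe
  fix V d assume d: "(V, d) \<in> A"
  have o: "open (d ` (V \<inter> W))" using chart_image_open[OF d W(1)] .
  have "smooth_on (d ` (V \<inter> W)) (c \<circ> inv_into V d)"
    using transition_smooth[OF d c] W(2) unfolding smooth_on_def
    by (meson Ck_on_subset Int_mono image_mono order_refl)
  moreover have sub: "(c \<circ> inv_into V d) ` d ` (V \<inter> W) \<subseteq> c ` W"
    by (auto simp: chart_inv[OF d])
  ultimately have "smooth_on (d ` (V \<inter> W)) (\<lambda>x. (f \<circ> inv_into U c) ((c \<circ> inv_into V d) x))"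
    using f unfolding smooth_on_def
    by (blast intro: Ck_on_compose[OF o sub])
  then show "smooth_on (d ` (V \<inter> W)) (f \<circ> inv_into V d)"
    by (rule smooth_on_cong[OF o, rotated])
      (use W(2) in \<open>auto simp: chart_inv[OF d] subset_eq chart_inv[OF c]\<close>)
qed

lemma coordinate_smooth:
  assumes c: "(U, c) \<in> A"
  shows "smooth_fun A U (\<lambda>q. c q $ i)"
proof (rule smooth_fun_chartI[OF c chart_open[OF c] order_refl])
  have "smooth_on (c ` U) (c \<circ> inv_into U c)" using transition_smooth[OF c c] by simp
  then show "smooth_on (c ` U) ((\<lambda>q. c q $ i) \<circ> inv_into U c)"
    unfolding smooth_on_def
    using Ck_on_bounded_linear[OF chart_image_open[OF c, of UNIV, simplified] bounded_linear_vec_nth[of i]]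
    by (auto simp: o_def)
qed

lemma smooth_nearI: "open W \<Longrightarrow> p \<in> W \<Longrightarrow> smooth_fun A W f \<Longrightarrow> smooth_near A p f"
  unfolding smooth_near_def by blast

lemma smooth_near_cong_imp:
  assumes "open W" "p \<in> W" "\<And>q. q \<in> W \<Longrightarrow> f q = h q" "smooth_near A p f"
  shows "smooth_near A p h"
proof -
  obtain V where V: "open V" "p \<in> V" "smooth_fun A V f"
    using assms(4) unfolding smooth_near_def by blast
  have "smooth_fun A (V \<inter> W) h"
    by (rule smooth_fun_cong[of _ f]) (use V assms smooth_fun_subset in auto)
  then show ?thesis using V assms by (intro smooth_nearI[of "V \<inter> W"]) auto
qed

lemma smooth_near_two:
  assumes "smooth_near A p f" "smooth_near A p h"
  obtains W where "open W" "p \<in> W" "smooth_fun A W f" "smooth_fun A W h"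
proof -
  obtain V W where "open V" "p \<in> V" "smooth_fun A V f" "open W" "p \<in> W" "smooth_fun A W h"
    using assms unfolding smooth_near_def by blast
  then show ?thesis
    by (intro that[of "V \<inter> W"]) (auto intro: smooth_fun_subset)
qed

lemma smooth_near_differentiable:
  assumes "smooth_near A p f" and c: "(U, c) \<in> A" "p \<in> U"
  shows "(f \<circ> inv_into U c) differentiable (at (c p))"
proof -
  obtain W where W: "open W" "p \<in> W" "smooth_fun A W f" using assms unfolding smooth_near_def by blast
  then have "smooth_on (c ` (U \<inter> W)) (f \<circ> inv_into U c)" using c unfolding smooth_fun_def by auto
  then show ?thesis by (rule smooth_on_differentiable) (use W c in auto)
qed

lemma chart_vector_has_derivative:
  assumes "smooth_near A p f" "(U, c) \<in> A" "p \<in> U"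
  shows "((f \<circ> inv_into U c) has_derivative (\<lambda>v. chart_vector A (U, c) p v f)) (at (c p))"
  using smooth_near_differentiable[OF assms] assms(1)
  by (simp add: chart_vector_def frechet_derivative_works[symmetric] cong: if_cong)

lemma chart_vector_eqI:
  assumes "smooth_near A p f" "((f \<circ> inv_into U c) has_derivative f') (at (c p))"
  shows "chart_vector A (U, c) p v f = f' v"
  using assms frechet_derivative_at[OF assms(2)] by (simp add: chart_vector_def)

lemma chart_vector_nonsmooth: "\<not> smooth_near A p f \<Longrightarrow> chart_vector A (U, c) p v f = 0"
  by (simp add: chart_vector_def)

lemma chart_vector_lincomb:
  assumes "(U, c) \<in> A" "p \<in> U"
  shows "chart_vector A (U, c) p (a *\<^sub>R v + w) =
     (\<lambda>f. a * chart_vector A (U, c) p v f + chart_vector A (U, c) p w f)"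
proof
  fix f
  show "chart_vector A (U, c) p (a *\<^sub>R v + w) f =
     a * chart_vector A (U, c) p v f + chart_vector A (U, c) p w f"
  proof (cases "smooth_near A p f")
    case True
    have "linear (\<lambda>v. chart_vector A (U, c) p v f)"
      using chart_vector_has_derivative[OF True assms] has_derivative_linear by blast
    from linear_add[OF this, of "a *\<^sub>R v" w] linear_cmul[OF this, of a v]
    show ?thesis by simp
  qed (simp add: chart_vector_nonsmooth)
qed

lemma chart_vector_sum:
  assumes "(U, c) \<in> A" "p \<in> U"
  shows "chart_vector A (U, c) p (\<Sum>k\<in>I. a k *\<^sub>R v k) = (\<lambda>f. \<Sum>k\<in>I. a k * chart_vector A (U, c) p (v k) f)"
proof (induction I rule: infinite_finite_induct)
  case (insert k I)
  then show ?case by (simp add: chart_vector_lincomb[OF assms])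
next
  case empty
  have "chart_vector A (U, c) p 0 = (\<lambda>f. 0)"
    using chart_vector_lincomb[OF assms, of "-1" 0 0] by (auto simp: fun_eq_iff)
  then show ?case by simp
next
  case (infinite I)
  have "chart_vector A (U, c) p 0 = (\<lambda>f. 0)"
    using chart_vector_lincomb[OF assms, of "-1" 0 0] by (auto simp: fun_eq_iff)
  then show ?case using infinite by simp
qed

text \<open>
  The chain rule along the transition map: its derivative at \<open>c p\<close> carries \<open>v\<close> to the coordinates \<open>w\<close>
  in the other chart.  Hence the tangent space is the image of any single chart, and in particular a
  linear space.
\<close>

lemma chart_vector_change:
  assumes c: "(U, c) \<in> A" "p \<in> U" and d: "(V, d) \<in> A" "p \<in> V"
  shows "\<exists>w. chart_vector A (U, c) p v = chart_vector A (V, d) p w"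
proof -
  have o: "open (c ` (U \<inter> V))" by (rule chart_image_open[OF c(1) chart_open[OF d(1)]])
  have "(d \<circ> inv_into U c) differentiable (at (c p))"
    by (rule smooth_on_differentiable[OF transition_smooth[OF c(1) d(1)]]) (use c d in auto)
  then obtain L where L: "((d \<circ> inv_into U c) has_derivative L) (at (c p))"
    unfolding differentiable_def by blast
  have "chart_vector A (U, c) p v f = chart_vector A (V, d) p (L v) f" for f
  proof (cases "smooth_near A p f")
    case True
    have "((f \<circ> inv_into V d) has_derivative (\<lambda>v. chart_vector A (V, d) p v f)) (at ((d \<circ> inv_into U c) (c p)))"
      using chart_vector_has_derivative[OF True d] by (simp add: chart_inv[OF c])
    from diff_chain_at[OF L this]
    have "((f \<circ> inv_into V d \<circ> (d \<circ> inv_into U c)) has_derivative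
        (\<lambda>v. chart_vector A (V, d) p (L v) f)) (at (c p))" by (simp add: o_def)
    then have "((f \<circ> inv_into U c) has_derivative (\<lambda>v. chart_vector A (V, d) p (L v) f)) (at (c p))"
      by (rule has_derivative_transform_within_open[OF _ o])
        (use c d in \<open>auto simp: chart_inv[OF c(1)] chart_inv[OF d(1)]\<close>)
    then show ?thesis by (rule chart_vector_eqI[OF True])
  qed (simp add: chart_vector_nonsmooth)
  then show ?thesis by blast
qed

lemma tangent_space_chart:
  assumes "u \<in> tangent_space A p" "(U, c) \<in> A" "p \<in> U"
  obtains v where "u = chart_vector A (U, c) p v"
  using assms chart_vector_change unfolding tangent_space_def by blast

lemma chart_vector_tangent:
  "(U, c) \<in> A \<Longrightarrow> p \<in> U \<Longrightarrow> chart_vector A (U, c) p v \<in> tangent_space A p"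
  unfolding tangent_space_def by blast

lemma tangent_lincomb:
  assumes "u \<in> tangent_space A p" "w \<in> tangent_space A p"
  shows "(\<lambda>f. a * u f + w f) \<in> tangent_space A p"
proof -
  obtain U c where c: "(U, c) \<in> A" "p \<in> U" using chart_at .
  obtain u' w' where "u = chart_vector A (U, c) p u'" "w = chart_vector A (U, c) p w'"
    using tangent_space_chart[OF _ c] assms by metis
  then show ?thesis
    using chart_vector_lincomb[OF c, of a u' w'] chart_vector_tangent[OF c, of "a *\<^sub>R u' + w'"] by simp
qed

lemma tangent_zero: "(\<lambda>f. 0) \<in> tangent_space A p"
proof -
  obtain U c where c: "(U, c) \<in> A" "p \<in> U" using chart_at .
  have "chart_vector A (U, c) p 0 = (\<lambda>f. 0)"
    using chart_vector_lincomb[OF c, of "-1" 0 0] by (auto simp: fun_eq_iff)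
  then show ?thesis using chart_vector_tangent[OF c, of 0] by simp
qed

text \<open>
  Tangent vectors act on germs.  Even for functions that are not smooth near \<open>p\<close> this holds, because
  smoothness near \<open>p\<close> is itself a property of the germ.
\<close>

lemma tangent_cong:
  assumes u: "u \<in> tangent_space A p" and W: "open W" "p \<in> W" and eq: "\<And>q. q \<in> W \<Longrightarrow> f q = h q"
  shows "u f = u h"
proof -
  obtain U c v where c: "(U, c) \<in> A" "p \<in> U" and v: "u = chart_vector A (U, c) p v"
    using u unfolding tangent_space_def by blast
  have near: "smooth_near A p f \<longleftrightarrow> smooth_near A p h"
    using smooth_near_cong_imp[OF W] eq by metis
  show ?thesis
  proof (cases "smooth_near A p f")
    case True
    have "((h \<circ> inv_into U c) has_derivative (\<lambda>v. chart_vector A (U, c) p v f)) (at (c p))"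
      by (rule has_derivative_transform_within_open[OF chart_vector_has_derivative[OF True c]
            chart_image_open[OF c(1) W(1)]])
        (use W c eq in \<open>auto simp: chart_inv[OF c(1)]\<close>)
    then show ?thesis using chart_vector_eqI near True v by metis
  qed (use near chart_vector_nonsmooth v in auto)
qed

lemma tangent_const:
  assumes "u \<in> tangent_space A p"
  shows "u (\<lambda>q. b) = 0"
proof -
  obtain U c v where c: "(U, c) \<in> A" "p \<in> U" and v: "u = chart_vector A (U, c) p v"
    using assms unfolding tangent_space_def by blast
  have "chart_vector A (U, c) p v (\<lambda>q. b) = (\<lambda>v. 0) v"
    by (rule chart_vector_eqI)
      (auto simp: o_def intro!: smooth_nearI[of UNIV] smooth_fun_const)
  then show ?thesis using v by simp
qed

lemma tangent_add:
  assumes u: "u \<in> tangent_space A p" and s: "smooth_near A p f" "smooth_near A p h"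
  shows "u (\<lambda>q. f q + h q) = u f + u h"
proof -
  obtain U c v where c: "(U, c) \<in> A" "p \<in> U" and v: "u = chart_vector A (U, c) p v"
    using assms unfolding tangent_space_def by blast
  obtain W where W: "open W" "p \<in> W" "smooth_fun A W f" "smooth_fun A W h"
    using smooth_near_two[OF s] .
  have "chart_vector A (U, c) p v (\<lambda>q. f q + h q)
      = (\<lambda>v. chart_vector A (U, c) p v f + chart_vector A (U, c) p v h) v"
  proof (rule chart_vector_eqI)
    show "smooth_near A p (\<lambda>q. f q + h q)"
      using W by (intro smooth_nearI[OF W(1,2)] smooth_fun_add)
    show "((\<lambda>q. f q + h q) \<circ> inv_into U c has_derivative
     (\<lambda>v. chart_vector A (U, c) p v f + chart_vector A (U, c) p v h)) (at (c p))"
      using has_derivative_add[OF chart_vector_has_derivative[OF s(1) c] chart_vector_has_derivative[OF s(2) c]]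
      by (simp add: o_def)
  qed
  then show ?thesis using v by simp
qed

lemma tangent_mult:
  assumes u: "u \<in> tangent_space A p" and s: "smooth_near A p f" "smooth_near A p h"
  shows "u (\<lambda>q. f q * h q) = f p * u h + u f * h p"
proof -
  obtain U c v where c: "(U, c) \<in> A" "p \<in> U" and v: "u = chart_vector A (U, c) p v"
    using assms unfolding tangent_space_def by blast
  obtain W where W: "open W" "p \<in> W" "smooth_fun A W f" "smooth_fun A W h"
    using smooth_near_two[OF s] .
  have "chart_vector A (U, c) p v (\<lambda>q. f q * h q)
      = (\<lambda>v. f p * chart_vector A (U, c) p v h + chart_vector A (U, c) p v f * h p) v"
  proof (rule chart_vector_eqI)
    show "smooth_near A p (\<lambda>q. f q * h q)"
      using W by (intro smooth_nearI[OF W(1,2)] smooth_fun_mult)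
    show "((\<lambda>q. f q * h q) \<circ> inv_into U c has_derivative
     (\<lambda>v. f p * chart_vector A (U, c) p v h + chart_vector A (U, c) p v f * h p)) (at (c p))"
      using has_derivative_mult[OF chart_vector_has_derivative[OF s(1) c] chart_vector_has_derivative[OF s(2) c]]
      by (simp add: o_def chart_inv[OF c])
  qed
  then show ?thesis using v by simp
qed

lemma tangent_scale: "u \<in> tangent_space A p \<Longrightarrow> (\<lambda>f. a * u f) \<in> tangent_space A p"
  using tangent_lincomb[of u p "\<lambda>f. 0" a] tangent_zero by simp

lemma tangent_plus: "u \<in> tangent_space A p \<Longrightarrow> v \<in> tangent_space A p \<Longrightarrow> (\<lambda>f. u f + v f) \<in> tangent_space A p"
  using tangent_lincomb[of u p v 1] by simp

lemma tangent_minus: "u \<in> tangent_space A p \<Longrightarrow> v \<in> tangent_space A p \<Longrightarrow> (\<lambda>f. u f - v f) \<in> tangent_space A p"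
  using tangent_lincomb[of v p u "-1"] by (simp add: algebra_simps)

lemma tangent_sum: "(\<And>k. k \<in> I \<Longrightarrow> u k \<in> tangent_space A p) \<Longrightarrow>
    (\<lambda>f. \<Sum>k\<in>I. a k * u k f) \<in> tangent_space A p"
  by (induction I rule: infinite_finite_induct) (auto simp: tangent_zero intro: tangent_lincomb)

lemma vector_field_tangent: "vector_field A W X \<Longrightarrow> p \<in> W \<Longrightarrow> X p \<in> tangent_space A p"
  unfolding vector_field_def by blast

lemma vector_field_smooth:
  "vector_field A W X \<Longrightarrow> open W \<Longrightarrow> smooth_fun A W f \<Longrightarrow> smooth_fun A W (\<lambda>q. X q f)"
  unfolding vector_field_def by blast

lemma vector_field_subset: "vector_field A W X \<Longrightarrow> W' \<subseteq> W \<Longrightarrow> vector_field A W' X"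
  unfolding vector_field_def by (meson order_trans subsetD)

lemma vector_field_cong:
  assumes "vector_field A W X" "\<And>q. q \<in> W \<Longrightarrow> X q = Y q"
  shows "vector_field A W Y"
proof -
  have "smooth_fun A W' (\<lambda>p. Y p f)" if "open W'" "W' \<subseteq> W" "smooth_fun A W' f" for W' f
    by (rule smooth_fun_cong[of W' "\<lambda>p. X p f"])
      (use that assms in \<open>auto simp: vector_field_def subset_eq\<close>)
  then show ?thesis using assms unfolding vector_field_def by auto
qed

lemma vector_field_lincomb:
  assumes "vector_field A W X" "vector_field A W Y" "smooth_fun A W h"
  shows "vector_field A W (\<lambda>q f. h q * X q f + Y q f)"
  using assms unfolding vector_field_def
  by (auto intro!: tangent_lincomb smooth_fun_add smooth_fun_mult intro: smooth_fun_subset)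

lemma vector_field_zero: "vector_field A W (\<lambda>q f. 0)"
  unfolding vector_field_def by (auto intro: tangent_zero smooth_fun_const)

lemma vector_field_scale:
  assumes "vector_field A W X" "smooth_fun A W h"
  shows "vector_field A W (\<lambda>q f. h q * X q f)"
  using vector_field_lincomb[OF assms(1) vector_field_zero assms(2)] by simp

lemma vector_field_add:
  assumes "vector_field A W X" "vector_field A W Y"
  shows "vector_field A W (\<lambda>q f. X q f + Y q f)"
  using vector_field_lincomb[OF assms smooth_fun_const[of W 1]] by simp

lemma vector_field_diff:
  assumes "vector_field A W X" "vector_field A W Y"
  shows "vector_field A W (\<lambda>q f. X q f - Y q f)"
  using vector_field_lincomb[OF assms(2,1) smooth_fun_const[of W "-1"]] by (simp add: algebra_simps)

lemma vector_field_sum: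
  assumes "\<And>k. k \<in> I \<Longrightarrow> vector_field A W (X k)"
  shows "vector_field A W (\<lambda>q f. \<Sum>k\<in>I. X k q f)"
  using assms
  by (induction I rule: infinite_finite_induct) (auto simp: vector_field_zero intro: vector_field_add)

lemma coordinate_field:
  assumes c: "(U, c) \<in> A"
  shows "vector_field A U (\<lambda>p. chart_vector A (U, c) p v)"
  unfolding vector_field_def
proof (intro conjI ballI allI impI)
  show "p \<in> U \<Longrightarrow> chart_vector A (U, c) p v \<in> tangent_space A p" for p
    by (rule chart_vector_tangent[OF c])
  fix W f assume W: "open W \<and> W \<subseteq> U \<and> smooth_fun A W f"
  have "smooth_on (c ` (U \<inter> W)) (f \<circ> inv_into U c)"
    using W c unfolding smooth_fun_def by auto
  then have s: "smooth_on (c ` W) (\<lambda>x. frechet_derivative (f \<circ> inv_into U c) (at x) v)"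
    using W smooth_on_frechet by (metis Int_absorb1)
  have o: "open (c ` W)" using chart_image_open[OF c, of W] W by (simp add: Int_absorb1)
  have "smooth_on (c ` W) ((\<lambda>p. chart_vector A (U, c) p v f) \<circ> inv_into U c)"
    by (rule smooth_on_cong[OF o _ s])
      (use W in \<open>auto simp: chart_inv[OF c] chart_vector_def subset_eq intro: smooth_nearI\<close>)
  then show "smooth_fun A W (\<lambda>p. chart_vector A (U, c) p v f)"
    using W by (intro smooth_fun_chartI[OF c]) auto
qed

text \<open>
  The coordinate functions recover the coordinates of a tangent vector; this is what makes the
  coordinate fields linearly independent.
\<close>

lemma chart_vector_coordinate:
  assumes c: "(U, c) \<in> A" "p \<in> U"
  shows "chart_vector A (U, c) p v (\<lambda>q. c q $ i) = v $ i"
proof -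
  have "chart_vector A (U, c) p v (\<lambda>q. c q $ i) = (\<lambda>v. v $ i) v"
  proof (rule chart_vector_eqI)
    show "smooth_near A p (\<lambda>q. c q $ i)"
      by (rule smooth_nearI[OF chart_open[OF c(1)] c(2) coordinate_smooth[OF c(1)]])
    have "((\<lambda>x. x $ i) has_derivative (\<lambda>v. v $ i)) (at (c p))"
      by (rule bounded_linear_imp_has_derivative[OF bounded_linear_vec_nth])
    then show "((\<lambda>q. c q $ i) \<circ> inv_into U c has_derivative (\<lambda>v. v $ i)) (at (c p))"
      by (rule has_derivative_transform_within_open[OF _ chart_image_open[OF c(1) open_UNIV]])
        (use c in \<open>auto simp: chart_inv[OF c(1)]\<close>)
  qed
  then show ?thesis by simp
qed

lemma lie_bracket_apply:
  "open W \<Longrightarrow> p \<in> W \<Longrightarrow> smooth_fun A W f \<Longrightarrow>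
    lie_bracket A X Y p f = X p (\<lambda>q. Y q f) - Y p (\<lambda>q. X q f)"
  unfolding lie_bracket_def using smooth_nearI by simp

end

section \<open>The metric and the connection on an open set\<close>

locale riemannian_manifold = smooth_manifold A
  for A :: "('m::{t2_space,second_countable_topology}, 'n::finite) chart set" +
  fixes g :: "'m \<Rightarrow> 'm tangent \<Rightarrow> 'm tangent \<Rightarrow> real"
    and D :: "'m field \<Rightarrow> 'm field \<Rightarrow> 'm field"
  assumes metric: "riemannian_metric A g"
    and connection: "levi_civita A g D"
begin

lemma g_sym:
  assumes "u \<in> tangent_space A p" "v \<in> tangent_space A p"
  shows "g p u v = g p v u"
  using metric[unfolded riemannian_metric_def, THEN conjunct1, rule_format, OF assms assms(1)] by simp

lemma g_lincomb:
  assumes "u \<in> tangent_space A p" "v \<in> tangent_space A p" "w \<in> tangent_space A p"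
  shows "g p (\<lambda>f. a * u f + v f) w = a * g p u w + g p v w"
  using metric[unfolded riemannian_metric_def, THEN conjunct1, rule_format, OF assms] by simp

lemma g_zero: "w \<in> tangent_space A p \<Longrightarrow> g p (\<lambda>f. 0) w = 0"
  using g_lincomb[OF tangent_zero tangent_zero, where p = p and w = w and a = 1] by simp

lemma g_scale: "u \<in> tangent_space A p \<Longrightarrow> w \<in> tangent_space A p \<Longrightarrow> g p (\<lambda>f. a * u f) w = a * g p u w"
  using g_lincomb[of u p "\<lambda>f. 0" w a] tangent_zero g_zero by simp

lemma g_add:
  "u \<in> tangent_space A p \<Longrightarrow> v \<in> tangent_space A p \<Longrightarrow> w \<in> tangent_space A p \<Longrightarrow>
    g p (\<lambda>f. u f + v f) w = g p u w + g p v w"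
  using g_lincomb[of u p v w 1] by simp

lemma g_diff:
  "u \<in> tangent_space A p \<Longrightarrow> v \<in> tangent_space A p \<Longrightarrow> w \<in> tangent_space A p \<Longrightarrow>
    g p (\<lambda>f. u f - v f) w = g p u w - g p v w"
  using g_lincomb[of v p u w "-1"] by (simp add: algebra_simps)

lemma g_sum:
  assumes "\<And>k. k \<in> I \<Longrightarrow> u k \<in> tangent_space A p" "w \<in> tangent_space A p"
  shows "g p (\<lambda>f. \<Sum>k\<in>I. a k * u k f) w = (\<Sum>k\<in>I. a k * g p (u k) w)"
  using assms(1)
  by (induction I rule: infinite_finite_induct) (auto simp: assms(2) g_zero g_lincomb tangent_sum)

lemma g_pos: "u \<in> tangent_space A p \<Longrightarrow> u \<noteq> (\<lambda>f. 0) \<Longrightarrow> g p u u > 0"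
  using metric[unfolded riemannian_metric_def, THEN conjunct2, THEN conjunct1] by simp

lemma g_smooth:
  "open W \<Longrightarrow> vector_field A W X \<Longrightarrow> vector_field A W Y \<Longrightarrow> smooth_fun A W (\<lambda>p. g p (X p) (Y p))"
  using metric[unfolded riemannian_metric_def, THEN conjunct2, THEN conjunct2] by simp

end

text \<open>
  All identities between vector fields are proved on one open set \<open>W\<close> on which the fields are smooth.
  Outside \<open>W\<close> the fields may be arbitrary.
\<close>

locale local_fields = riemannian_manifold A g D
  for A :: "('m::{t2_space,second_countable_topology}, 'n::finite) chart set" and g D +
  fixes W :: "'m set"
  assumes W: "open W"
begin

abbreviation vf :: "'m field \<Rightarrow> bool" where "vf X \<equiv> vector_field A W X"
abbreviation sm :: "('m \<Rightarrow> real) \<Rightarrow> bool" where "sm f \<equiv> smooth_fun A W f"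
abbreviation br :: "'m field \<Rightarrow> 'm field \<Rightarrow> 'm field" where "br \<equiv> lie_bracket A"
abbreviation Rm :: "'m field \<Rightarrow> 'm field \<Rightarrow> 'm field \<Rightarrow> 'm field" where "Rm \<equiv> curvature A D"

lemmas sm_intros = smooth_fun_add[OF W] smooth_fun_mult[OF W] smooth_fun_diff[OF W]
  smooth_fun_minus[OF W] smooth_fun_const g_smooth[OF W]
lemmas vf_intros = vector_field_lincomb vector_field_add vector_field_diff vector_field_scale

lemma deriv_sm: "vf X \<Longrightarrow> sm f \<Longrightarrow> sm (\<lambda>q. X q f)"
  using vector_field_smooth W by blast

lemma sm_near: "sm f \<Longrightarrow> p \<in> W \<Longrightarrow> smooth_near A p f"
  using smooth_nearI[OF W] by blast

lemma vf_tangent: "vf X \<Longrightarrow> p \<in> W \<Longrightarrow> X p \<in> tangent_space A p"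
  by (rule vector_field_tangent)

lemma deriv_cong: "vf X \<Longrightarrow> p \<in> W \<Longrightarrow> (\<And>q. q \<in> W \<Longrightarrow> f q = h q) \<Longrightarrow> X p f = X p h"
  using tangent_cong[OF vf_tangent W] by blast

lemma deriv_const: "vf X \<Longrightarrow> p \<in> W \<Longrightarrow> X p (\<lambda>q. b) = 0"
  using tangent_const[OF vf_tangent] by blast

lemma deriv_add: "vf X \<Longrightarrow> p \<in> W \<Longrightarrow> sm f \<Longrightarrow> sm h \<Longrightarrow> X p (\<lambda>q. f q + h q) = X p f + X p h"
  using tangent_add[OF vf_tangent] sm_near by blast

lemma deriv_mult: "vf X \<Longrightarrow> p \<in> W \<Longrightarrow> sm f \<Longrightarrow> sm h \<Longrightarrow> X p (\<lambda>q. f q * h q) = f p * X p h + X p f * h p"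
  using tangent_mult[OF vf_tangent] sm_near by blast

lemma deriv_cmult: "vf X \<Longrightarrow> p \<in> W \<Longrightarrow> sm f \<Longrightarrow> X p (\<lambda>q. b * f q) = b * X p f"
  using deriv_mult[of X p "\<lambda>q. b" f] by (simp add: smooth_fun_const deriv_const)

lemma deriv_diff: "vf X \<Longrightarrow> p \<in> W \<Longrightarrow> sm f \<Longrightarrow> sm h \<Longrightarrow> X p (\<lambda>q. f q - h q) = X p f - X p h"
  using deriv_add[of X p f "\<lambda>q. (-1) * h q"] deriv_cmult[of X p h "-1"]
  by (simp add: sm_intros)

lemma deriv_sum:
  assumes "vf X" "p \<in> W"
  shows "(\<And>k. k \<in> I \<Longrightarrow> sm (f k)) \<Longrightarrow> X p (\<lambda>q. \<Sum>k\<in>I. f k q) = (\<Sum>k\<in>I. X p (f k))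
     \<and> sm (\<lambda>q. \<Sum>k\<in>I. f k q)"
  by (induction I rule: infinite_finite_induct)
    (auto simp: deriv_const[OF assms] deriv_add[OF assms] intro: sm_intros)

lemma bracket_apply: "p \<in> W \<Longrightarrow> sm f \<Longrightarrow> br X Y p f = X p (\<lambda>q. Y q f) - Y p (\<lambda>q. X q f)"
  using lie_bracket_apply[OF W] by blast

lemma D_axioms:
  assumes "vf X" "vf Y" "vf Z" "sm h"
  shows "vf (D X Y)"
    and "p \<in> W \<Longrightarrow> D (\<lambda>q f. h q * X q f + Y q f) Z p = (\<lambda>f. h p * D X Z p f + D Y Z p f)"
    and "p \<in> W \<Longrightarrow> D X (\<lambda>q f. Y q f + Z q f) p = (\<lambda>f. D X Y p f + D X Z p f)"
    and "p \<in> W \<Longrightarrow> D X (\<lambda>q f. h q * Y q f) p = (\<lambda>f. X p h * Y p f + h p * D X Y p f)"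
    and "p \<in> W \<Longrightarrow> (\<lambda>f. D X Y p f - D Y X p f) = br X Y p"
    and "p \<in> W \<Longrightarrow> X p (\<lambda>q. g q (Y q) (Z q)) = g p (D X Y p) (Z p) + g p (Y p) (D X Z p)"
  using connection[unfolded levi_civita_def, rule_format, of W X Y Z h] assms W by blast+

lemma D_vf [intro]: "vf X \<Longrightarrow> vf Y \<Longrightarrow> vf (D X Y)"
  using D_axioms(1)[of X Y X "\<lambda>q. 0"] smooth_fun_const by blast

lemma D_torsion: "vf X \<Longrightarrow> vf Y \<Longrightarrow> p \<in> W \<Longrightarrow> br X Y p f = D X Y p f - D Y X p f"
  using D_axioms(5)[of X Y X "\<lambda>q. 0" p] smooth_fun_const by (metis (no_types))

lemma D_metric: "vf X \<Longrightarrow> vf Y \<Longrightarrow> vf Z \<Longrightarrow> p \<in> W \<Longrightarrow>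
  X p (\<lambda>q. g q (Y q) (Z q)) = g p (D X Y p) (Z p) + g p (Y p) (D X Z p)"
  using D_axioms(6)[of X Y Z "\<lambda>q. 0" p] smooth_fun_const by blast

text \<open>
  Vanishing of the torsion expresses the bracket through the connection, which takes smooth fields to
  smooth fields.
\<close>

lemma bracket_vf: "vf X \<Longrightarrow> vf Y \<Longrightarrow> vf (br X Y)"
  by (rule vector_field_cong[of W "\<lambda>q f. D X Y q f - D Y X q f"])
    (auto simp: fun_eq_iff D_torsion intro: vf_intros)

lemma D_zero_left: "vf Z \<Longrightarrow> p \<in> W \<Longrightarrow> D (\<lambda>q f. 0) Z p = (\<lambda>f. 0)"
  using D_axioms(2)[of "\<lambda>q f. 0" "\<lambda>q f. 0" Z "\<lambda>q. 1" p] 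
  by (simp add: vector_field_zero smooth_fun_const fun_eq_iff)

text \<open>
  The axioms of a connection speak about fields as functions on the whole manifold, so locality in
  \<open>W\<close> has to be derived.  With \<open>h\<close> equal to 0 on \<open>W\<close> and 1 elsewhere, \<open>h\<close> is smooth on \<open>W\<close>, and a field
  \<open>N\<close> that vanishes on \<open>W\<close> equals \<open>h N\<close> everywhere; linearity over functions then gives the claim.
\<close>

lemma D_vanish_left:
  assumes N: "\<And>q. q \<in> W \<Longrightarrow> N q = (\<lambda>f. 0)" and Z: "vf Z" and p: "p \<in> W"
  shows "D N Z p = (\<lambda>f. 0)"
proof -
  define h :: "'m \<Rightarrow> real" where "h = (\<lambda>q. if q \<in> W then 0 else 1)"
  have h: "sm h" by (rule smooth_fun_cong[OF W _ smooth_fun_const[of W 0]]) (simp add: h_def)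
  have v: "vf N" by (rule vector_field_cong[OF vector_field_zero]) (use N in simp)
  have "(\<lambda>q f. h q * N q f + 0) = N" using N by (auto simp: h_def fun_eq_iff)
  then show ?thesis
    using D_axioms(2)[OF v vector_field_zero Z h p] p by (simp add: h_def D_zero_left[OF Z p])
qed

lemma D_vanish_right:
  assumes N: "\<And>q. q \<in> W \<Longrightarrow> N q = (\<lambda>f. 0)" and Z: "vf Z" and p: "p \<in> W"
  shows "D Z N p = (\<lambda>f. 0)"
proof -
  define h :: "'m \<Rightarrow> real" where "h = (\<lambda>q. if q \<in> W then 0 else 1)"
  have h: "sm h" by (rule smooth_fun_cong[OF W _ smooth_fun_const[of W 0]]) (simp add: h_def)
  have v: "vf N" by (rule vector_field_cong[OF vector_field_zero]) (use N in simp)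
  have "(\<lambda>q f. h q * N q f) = N" using N by (auto simp: h_def fun_eq_iff)
  then show ?thesis
    using D_axioms(4)[OF Z v Z h p] p N[OF p] by (simp add: h_def)
qed

lemma D_cong:
  assumes "vf X" "vf Y" "\<And>q. q \<in> W \<Longrightarrow> X q = X' q" "\<And>q. q \<in> W \<Longrightarrow> Y q = Y' q" "p \<in> W"
  shows "D X Y p = D X' Y' p"
proof -
  have X': "vf X'" and Y': "vf Y'" using vector_field_cong assms by blast+
  define P where "P = (\<lambda>q f. X' q f - X q f)"
  define Q where "Q = (\<lambda>q f. Y' q f - Y q f)"
  have P: "vf P" "\<And>q. q \<in> W \<Longrightarrow> P q = (\<lambda>f. 0)" and Q: "vf Q" "\<And>q. q \<in> W \<Longrightarrow> Q q = (\<lambda>f. 0)"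
    using assms X' Y' by (auto simp: P_def Q_def intro: vf_intros)
  have "(\<lambda>q f. 1 * X q f + P q f) = X'" "(\<lambda>q f. Y q f + Q q f) = Y'"
    by (auto simp: P_def Q_def)
  with D_axioms(2)[OF assms(1) P(1) Y' smooth_fun_const[of W 1] assms(5)]
    D_axioms(3)[OF assms(1,2) Q(1) smooth_fun_const[of W 0] assms(5)]
  show ?thesis
    using D_vanish_left[OF P(2) Y' assms(5)] D_vanish_right[OF Q(2) assms(1,5)] by simp
qed

lemma D_lincomb_left:
  "vf X \<Longrightarrow> vf Y \<Longrightarrow> vf Z \<Longrightarrow> sm h \<Longrightarrow> p \<in> W \<Longrightarrow>
    D (\<lambda>q f. h q * X q f + Y q f) Z p f = h p * D X Z p f + D Y Z p f"
  using D_axioms(2) by simp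

lemma D_lincomb_right:
  assumes "vf X" "vf Y" "vf Z" "sm h" "p \<in> W"
  shows "D X (\<lambda>q f. h q * Y q f + Z q f) p f = X p h * Y p f + h p * D X Y p f + D X Z p f"
  using D_axioms(3)[OF assms(1) vector_field_scale[OF assms(2,4)] assms(3,4,5)]
    D_axioms(4)[OF assms] by simp

lemma D_add_left: "vf X \<Longrightarrow> vf Y \<Longrightarrow> vf Z \<Longrightarrow> p \<in> W \<Longrightarrow>
    D (\<lambda>q f. X q f + Y q f) Z p f = D X Z p f + D Y Z p f"
  using D_lincomb_left[of X Y Z "\<lambda>q. 1" p f] by (simp add: smooth_fun_const)

lemma D_diff_left: "vf X \<Longrightarrow> vf Y \<Longrightarrow> vf Z \<Longrightarrow> p \<in> W \<Longrightarrow>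
    D (\<lambda>q f. X q f - Y q f) Z p f = D X Z p f - D Y Z p f"
  using D_lincomb_left[of Y X Z "\<lambda>q. -1" p f] by (simp add: smooth_fun_const algebra_simps)

lemma D_scale_left: "vf X \<Longrightarrow> vf Z \<Longrightarrow> sm h \<Longrightarrow> p \<in> W \<Longrightarrow>
    D (\<lambda>q f. h q * X q f) Z p f = h p * D X Z p f"
  using D_lincomb_left[of X "\<lambda>q f. 0" Z h p f] D_zero_left[of Z p] by (simp add: vector_field_zero)

lemma D_diff_right: "vf X \<Longrightarrow> vf Y \<Longrightarrow> vf Z \<Longrightarrow> p \<in> W \<Longrightarrow>
    D X (\<lambda>q f. Y q f - Z q f) p f = D X Y p f - D X Z p f"
  using D_lincomb_right[of X Z Y "\<lambda>q. -1" p f] by (simp add: smooth_fun_const deriv_const algebra_simps)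

lemma D_scale_right: "vf X \<Longrightarrow> vf Y \<Longrightarrow> sm h \<Longrightarrow> p \<in> W \<Longrightarrow>
    D X (\<lambda>q f. h q * Y q f) p f = X p h * Y p f + h p * D X Y p f"
  using D_axioms(4)[of X Y X h p] by simp

text \<open>
  At a function that is smooth near \<open>p\<close> the identity is the usual cancellation of iterated derivatives
  on a smaller open set; at all other functions both sides are 0 by convention.
\<close>

lemma bracket_jacobi:
  assumes v: "vf X" "vf Y" "vf Z" and p: "p \<in> W"
  shows "br (br X Y) Z p f + br (br Y Z) X p f + br (br Z X) Y p f = 0"
proof (cases "smooth_near A p f")
  case True
  then obtain V where V: "open V" "p \<in> V" "smooth_fun A V f"
    unfolding smooth_near_def by blast
  interpret V: local_fields A g D "V \<inter> W"
    by unfold_locales (use V W in auto)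
  have v': "V.vf X" "V.vf Y" "V.vf Z" using v by (auto intro: vector_field_subset)
  have f: "V.sm f" using V(3) by (auto intro: smooth_fun_subset)
  have p': "p \<in> V \<inter> W" using V p by simp
  have "br (br P Q) S p f = P p (\<lambda>q. Q q (\<lambda>r. S r f)) - Q p (\<lambda>q. P q (\<lambda>r. S r f))
      - (S p (\<lambda>q. P q (\<lambda>r. Q r f)) - S p (\<lambda>q. Q q (\<lambda>r. P r f)))"
    if "V.vf P" "V.vf Q" "V.vf S" for P Q S
  proof -
    have s: "V.sm (\<lambda>q. T q f)" if "V.vf T" for T using that f by (rule V.deriv_sm)
    have "br (br P Q) S p f = br P Q p (\<lambda>q. S q f) - S p (\<lambda>q. br P Q q f)"
      by (rule V.bracket_apply[OF p' f])
    also have "S p (\<lambda>q. br P Q q f) = S p (\<lambda>q. P q (\<lambda>r. Q r f) - Q q (\<lambda>r. P r f))"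
      by (rule V.deriv_cong[OF that(3) p' V.bracket_apply[OF _ f]])
    also have "\<dots> = S p (\<lambda>q. P q (\<lambda>r. Q r f)) - S p (\<lambda>q. Q q (\<lambda>r. P r f))"
      by (rule V.deriv_diff[OF that(3) p' V.deriv_sm V.deriv_sm]) (intro s that)+
    also have "br P Q p (\<lambda>q. S q f) = P p (\<lambda>q. Q q (\<lambda>r. S r f)) - Q p (\<lambda>q. P q (\<lambda>r. S r f))"
      by (rule V.bracket_apply[OF p' s[OF that(3)]])
    finally show ?thesis .
  qed
  then show ?thesis using v' by simp
qed (simp add: lie_bracket_def)

lemma bracket_anticommute: "br Y X p f = - br X Y p f"
  by (simp add: lie_bracket_def)

section \<open>Symmetries of the curvature tensor\<close>

lemma Rm_vf [intro]: "vf X \<Longrightarrow> vf Y \<Longrightarrow> vf Z \<Longrightarrow> vf (Rm X Y Z)"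
proof -
  assume "vf X" "vf Y" "vf Z"
  then have "vf (\<lambda>p f. D X (D Y Z) p f - D Y (D X Z) p f - D (br X Y) Z p f)"
    by (intro vf_intros D_vf bracket_vf)
  then show ?thesis by (simp add: curvature_def[abs_def])
qed

lemma Rm_eq: "Rm X Y Z = (\<lambda>p f. D X (D Y Z) p f - D Y (D X Z) p f - D (br X Y) Z p f)"
  by (simp add: curvature_def fun_eq_iff)

lemma bracket_cong:
  assumes "vf X" "vf Y" "\<And>q. q \<in> W \<Longrightarrow> X q = X' q" "\<And>q. q \<in> W \<Longrightarrow> Y q = Y' q" "p \<in> W"
  shows "br X Y p = br X' Y' p"
proof -
  have "vf X'" "vf Y'" using vector_field_cong assms by blast+
  then show ?thesis
    using D_cong[OF assms(1,2,3,4,5)] D_cong[OF assms(2,1,4,3,5)] assms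
    by (auto simp: fun_eq_iff D_torsion)
qed

lemma bracket_jacobi_derivation:
  assumes v: "vf X" "vf Y" "vf Z" and p: "p \<in> W"
  shows "br X (br Y Z) p f = br (br X Y) Z p f + br Y (br X Z) p f"
proof -
  have 1: "br Z X q = (\<lambda>q f. (-1) * br X Z q f) q" for q
    using bracket_anticommute[of X Z] by (simp add: fun_eq_iff)
  have "br (br Z X) Y p = br (\<lambda>q f. (-1) * br X Z q f) Y p"
    by (rule bracket_cong[OF bracket_vf[OF v(3,1)] v(2) 1 refl p])
  then have "br (br Z X) Y p f = br (\<lambda>q f. (-1) * br X Z q f) Y p f" by (rule fun_cong)
  also have "\<dots> = D (\<lambda>q f. (-1) * br X Z q f) Y p f - D Y (\<lambda>q f. (-1) * br X Z q f) p f"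
    by (intro D_torsion vf_intros smooth_fun_const bracket_vf v p)
  also have "D (\<lambda>q f. (-1) * br X Z q f) Y p f = (-1) * D (br X Z) Y p f"
    by (intro D_scale_left smooth_fun_const bracket_vf v p)
  also have "D Y (\<lambda>q f. (-1) * br X Z q f) p f = Y p (\<lambda>q. -1) * br X Z p f + (-1) * D Y (br X Z) p f"
    by (intro D_scale_right smooth_fun_const bracket_vf v p)
  finally have "br (br Z X) Y p f = D Y (br X Z) p f - D (br X Z) Y p f"
    using deriv_const[OF v(2) p, of "-1"] by simp
  then have "br (br Z X) Y p f = br Y (br X Z) p f"
    using D_torsion[OF v(2) bracket_vf[OF v(1,3)] p, of f] by simp
  then show ?thesis
    using bracket_jacobi[OF v p, of f] bracket_anticommute[of X "br Y Z" p f] by linarith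
qed

lemma Rm_cong:
  assumes "vf X" "vf Y" "vf Z" "\<And>q. q \<in> W \<Longrightarrow> X q = X' q" "\<And>q. q \<in> W \<Longrightarrow> Y q = Y' q"
    "\<And>q. q \<in> W \<Longrightarrow> Z q = Z' q" "p \<in> W"
  shows "Rm X Y Z p = Rm X' Y' Z' p"
proof -
  have "D X (D Y Z) p = D X' (D Y' Z') p" "D Y (D X Z) p = D Y' (D X' Z') p"
    "D (br X Y) Z p = D (br X' Y') Z' p"
    by (rule D_cong; use assms in \<open>auto intro!: D_cong bracket_cong bracket_vf\<close>)+
  then show ?thesis by (simp add: Rm_eq)
qed

lemma Rm_anticommute:
  assumes "vf X" "vf Y" "vf Z" "p \<in> W"
  shows "Rm Y X Z p f = - Rm X Y Z p f"
proof -
  have "D (br Y X) Z p f = D (\<lambda>q f. (-1) * br X Y q f) Z p f"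
    using bracket_anticommute[of Y X] by (auto simp: fun_eq_iff intro!: arg_cong[of _ _ "\<lambda>T. D T Z p f"])
  also have "\<dots> = - D (br X Y) Z p f"
    using D_scale_left[of "br X Y" Z "\<lambda>q. -1" p f] assms bracket_vf smooth_fun_const by simp
  finally show ?thesis by (simp add: curvature_def)
qed

text \<open>
  The derivative of \<open>h\<close> that enters through \<open>D Z (D (h X + Y) V)\<close> cancels against the one that enters
  through the bracket \<open>[h X + Y, Z] = h [X, Z] + [Y, Z] - (Z h) X\<close>.
\<close>

lemma Rm_lincomb_left:
  assumes v: "vf X" "vf Y" "vf Z" "vf V" and h: "sm h" and p: "p \<in> W"
  shows "Rm (\<lambda>q f. h q * X q f + Y q f) Z V p f = h p * Rm X Z V p f + Rm Y Z V p f"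
proof -
  let ?F = "\<lambda>q f. h q * X q f + Y q f"
  let ?B = "\<lambda>q f. h q * br X Z q f + (br Y Z q f - Z q h * X q f)"
  note vI = v h deriv_sm[OF v(3) h] bracket_vf D_vf vf_intros sm_intros
  have F: "vf ?F" by (intro vI)
  have "br ?F Z q = ?B q" if "q \<in> W" for q
  proof
    fix f
    show "br ?F Z q f = ?B q f"
      using D_torsion[OF F v(3) that, of f] D_lincomb_left[OF v(1,2,3) h that, of f]
        D_lincomb_right[OF v(3,1,2) h that, of f] D_torsion[OF v(1,3) that, of f]
        D_torsion[OF v(2,3) that, of f]
      by (simp add: right_diff_distrib)
  qed
  then have "D (br ?F Z) V p = D ?B V p"
    by (intro D_cong vI F p) auto
  also have "\<dots> = (\<lambda>f. h p * D (br X Z) V p f + (D (br Y Z) V p f - Z p h * D X V p f))"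
  proof
    fix f
    have "D ?B V p f = h p * D (br X Z) V p f + D (\<lambda>q f. br Y Z q f - Z q h * X q f) V p f"
      by (intro D_lincomb_left vI p)
    also have "D (\<lambda>q f. br Y Z q f - Z q h * X q f) V p f
        = D (br Y Z) V p f - D (\<lambda>q f. Z q h * X q f) V p f"
      by (intro D_diff_left vI p)
    also have "D (\<lambda>q f. Z q h * X q f) V p f = Z p h * D X V p f"
      by (intro D_scale_left vI p)
    finally show "D ?B V p f = h p * D (br X Z) V p f + (D (br Y Z) V p f - Z p h * D X V p f)" .
  qed
  finally have 1: "D (br ?F Z) V p f = h p * D (br X Z) V p f + (D (br Y Z) V p f - Z p h * D X V p f)"
    by simp
  have 2: "D ?F (D Z V) p f = h p * D X (D Z V) p f + D Y (D Z V) p f"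
    by (intro D_lincomb_left vI p)
  have "D Z (D ?F V) p = D Z (\<lambda>q f. h q * D X V q f + D Y V q f) p"
    by (intro D_cong) (auto intro!: vI F p simp: fun_eq_iff D_lincomb_left v h)
  then have 3: "D Z (D ?F V) p f = Z p h * D X V p f + h p * D Z (D X V) p f + D Z (D Y V) p f"
    using D_lincomb_right[of Z "D X V" "D Y V" h p f] v h p by auto
  show ?thesis unfolding curvature_def 1 2 3 by (simp add: algebra_simps)
qed

text \<open>
  The second derivatives of \<open>h\<close> combine to \<open>X (Y h) - Y (X h) - [X, Y] h = 0\<close>, and the terms with one
  derivative of \<open>h\<close> cancel by symmetry.
\<close>

lemma Rm_lincomb_right:
  assumes v: "vf X" "vf Y" "vf Z" "vf V" and h: "sm h" and p: "p \<in> W"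
  shows "Rm X Y (\<lambda>q f. h q * Z q f + V q f) p f = h p * Rm X Y Z p f + Rm X Y V p f"
proof -
  let ?F = "\<lambda>q f. h q * Z q f + V q f"
  note vI = v h bracket_vf D_vf vf_intros sm_intros
  have F: "vf ?F" by (intro vI)
  have 1: "D P (D Q ?F) p f = P p (\<lambda>q. Q q h) * Z p f + Q p h * D P Z p f
      + (P p h * D Q Z p f + h p * D P (D Q Z) p f + D P (D Q V) p f)" if "vf P" "vf Q" for P Q
  proof -
    note vI = vI that deriv_sm[OF that(2) h]
    have "D P (D Q ?F) p = D P (\<lambda>q f. Q q h * Z q f + (h q * D Q Z q f + D Q V q f)) p"
      by (intro D_cong) (auto intro!: vI F p simp: fun_eq_iff D_lincomb_right v h that)
    then have "D P (D Q ?F) p f = D P (\<lambda>q f. Q q h * Z q f + (h q * D Q Z q f + D Q V q f)) p f"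
      by simp
    also have "\<dots> = P p (\<lambda>q. Q q h) * Z p f + Q p h * D P Z p f + D P (\<lambda>q f. h q * D Q Z q f + D Q V q f) p f"
      by (intro D_lincomb_right vI p)
    also have "D P (\<lambda>q f. h q * D Q Z q f + D Q V q f) p f
        = P p h * D Q Z p f + h p * D P (D Q Z) p f + D P (D Q V) p f"
      by (intro D_lincomb_right vI p)
    finally show ?thesis .
  qed
  have 2: "D (br X Y) ?F p f = (X p (\<lambda>q. Y q h) - Y p (\<lambda>q. X q h)) * Z p f + h p * D (br X Y) Z p f + D (br X Y) V p f"
    using D_lincomb_right[of "br X Y" Z V h p f] bracket_apply[OF p h, of X Y] v h p bracket_vf by simp
  show ?thesis unfolding curvature_def 1[OF v(1,2)] 1[OF v(2,1)] 2 by (simp add: algebra_simps)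
qed

lemma Rm_lincomb_middle:
  assumes v: "vf X" "vf Y" "vf Z" "vf V" and h: "sm h" and p: "p \<in> W"
  shows "Rm Z (\<lambda>q f. h q * X q f + Y q f) V p f = h p * Rm Z X V p f + Rm Z Y V p f"
proof -
  have F: "vf (\<lambda>q f. h q * X q f + Y q f)" using v h by (intro vf_intros)
  show ?thesis
    using Rm_anticommute[OF F v(3,4) p, of f] Rm_anticommute[OF v(1,3,4) p, of f]
      Rm_anticommute[OF v(2,3,4) p, of f] Rm_lincomb_left[OF v h p, of f] by simp
qed

text \<open>
  This is \<open>X (Y f) - Y (X f) - [X, Y] f = 0\<close> for the function \<open>f = g(Z, V)\<close>, expanded with the
  compatibility of \<open>D\<close> and \<open>g\<close>.
\<close>

lemma Rm_skew:
  assumes v: "vf X" "vf Y" "vf Z" "vf V" and p: "p \<in> W"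
  shows "g p (Rm X Y Z p) (V p) = - g p (Rm X Y V p) (Z p)"
proof -
  let ?i = "\<lambda>P Q q. g q (P q) (Q q)"
  note vI = v bracket_vf D_vf vf_intros sm_intros
  note t = vf_tangent[OF _ p]
  have s: "sm (?i Z V)" by (intro vI)
  have 1: "P p (\<lambda>q. Q q (?i Z V)) = ?i (D P (D Q Z)) V p + ?i (D Q Z) (D P V) p
      + (?i (D P Z) (D Q V) p + ?i Z (D P (D Q V)) p)" if "vf P" "vf Q" for P Q
  proof -
    note vI = vI that
    have "P p (\<lambda>q. Q q (?i Z V)) = P p (\<lambda>q. ?i (D Q Z) V q + ?i Z (D Q V) q)"
      by (rule deriv_cong[OF that(1) p D_metric[OF that(2) v(3,4)]])
    also have "\<dots> = P p (?i (D Q Z) V) + P p (?i Z (D Q V))"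
      by (intro deriv_add p vI)
    finally show ?thesis
      using D_metric[OF that(1) D_vf[OF that(2) v(3)] v(4) p] D_metric[OF that(1) v(3) D_vf[OF that(2) v(4)] p]
      by simp
  qed
  have 2: "?i (Rm X Y P) Q p = ?i (D X (D Y P)) Q p - ?i (D Y (D X P)) Q p - ?i (D (br X Y) P) Q p"
    if "vf P" "vf Q" for P Q
  proof -
    have "?i (Rm X Y P) Q p = g p (\<lambda>f. D X (D Y P) p f - D Y (D X P) p f) (Q p) - ?i (D (br X Y) P) Q p"
      unfolding Rm_eq
      by (rule g_diff[OF t[of "\<lambda>p f. D X (D Y P) p f - D Y (D X P) p f"] t t])
        (use that v in \<open>auto intro: bracket_vf vf_intros\<close>)
    then show ?thesis using g_diff[OF t t t, of "D X (D Y P)" "D Y (D X P)" Q] that v by auto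
  qed
  have 3: "br X Y p (?i Z V) = ?i (D (br X Y) Z) V p + ?i Z (D (br X Y) V) p"
    by (rule D_metric[OF bracket_vf[OF v(1,2)] v(3,4) p])
  have sym: "?i P Q p = ?i Q P p" if "vf P" "vf Q" for P Q
    using g_sym t that by blast
  have "?i Z (D X (D Y V)) p = ?i (D X (D Y V)) Z p" "?i Z (D Y (D X V)) p = ?i (D Y (D X V)) Z p"
    "?i Z (D (br X Y) V) p = ?i (D (br X Y) V) Z p"
    by (intro sym vI)+
  then show ?thesis
    using bracket_apply[OF p s, of X Y] 1[OF v(1,2)] 1[OF v(2,1)] 2[OF v(3,4)] 2[OF v(4,3)] 3
    by linarith
qed

text \<open>
  Without torsion, \<open>D X (D Y Z) - D X (D Z Y) = D X [Y, Z]\<close>, so that the cyclic sum reduces to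
  double brackets and vanishes by the Jacobi identity.
\<close>

lemma Rm_bianchi1:
  assumes v: "vf X" "vf Y" "vf Z" and p: "p \<in> W"
  shows "Rm X Y Z p f + Rm Y Z X p f + Rm Z X Y p f = 0"
proof -
  have 1: "D P (D Q S) p f - D P (D S Q) p f = D (br Q S) P p f - br (br Q S) P p f"
    if "vf P" "vf Q" "vf S" for P Q S
  proof -
    have "D P (\<lambda>q f. D Q S q f - D S Q q f) p f = D P (br Q S) p f"
      using D_cong[of P "\<lambda>q f. D Q S q f - D S Q q f" P "br Q S" p] that p
      by (auto simp: fun_eq_iff D_torsion intro: vf_intros)
    moreover have "br (br Q S) P p f = D (br Q S) P p f - D P (br Q S) p f"
      by (rule D_torsion[OF bracket_vf[OF that(2,3)] that(1) p])
    ultimately show ?thesis using D_diff_right[OF that(1) D_vf[OF that(2,3)] D_vf[OF that(3,2)] p, of f] by simp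
  qed
  show ?thesis
    using 1[OF v] 1[OF v(2,3,1)] 1[OF v(3,1,2)] bracket_jacobi[OF v p, of f]
    unfolding curvature_def by linarith
qed

text \<open>
  A formal consequence of the other symmetries: add the first Bianchi identities for the four cyclic
  rotations of \<open>(X, Y, Z, V)\<close> and cancel by skew-symmetry in either pair.
\<close>

lemma Rm_pair_symmetry:
  assumes v: "vf X" "vf Y" "vf Z" "vf V" and p: "p \<in> W"
  shows "g p (Rm X Y Z p) (V p) = g p (Rm Z V X p) (Y p)"
proof -
  let ?R = "\<lambda>X Y Z V. g p (Rm X Y Z p) (V p)"
  note t = vf_tangent[OF _ p]
  have anti: "?R Q P S T = - ?R P Q S T" if "vf P" "vf Q" "vf S" "vf T" for P Q S T
  proof -
    have "Rm Q P S p = (\<lambda>f. (-1) * Rm P Q S p f)"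
      using Rm_anticommute[OF that(1,2,3) p] by (simp add: fun_eq_iff)
    then show ?thesis using g_scale[OF t t, of "Rm P Q S" T "-1"] that by auto
  qed
  have bi: "?R P Q S T + ?R Q S P T + ?R S P Q T = 0" if "vf P" "vf Q" "vf S" "vf T" for P Q S T
  proof -
    have "Rm P Q S p = (\<lambda>f. (-1) * Rm Q S P p f - Rm S P Q p f)"
    proof
      fix f show "Rm P Q S p f = (-1) * Rm Q S P p f - Rm S P Q p f"
        using Rm_bianchi1[OF that(1,2,3) p, of f] by simp
    qed
    moreover have "g p (\<lambda>f. (-1) * Rm Q S P p f - Rm S P Q p f) (T p)
        = g p (\<lambda>f. (-1) * Rm Q S P p f) (T p) - ?R S P Q T"
      using that by (intro g_diff tangent_scale t Rm_vf)
    ultimately show ?thesis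
      using g_scale[OF t[OF Rm_vf[OF that(2,3,1)]] t[OF that(4)], of "-1"] by simp
  qed
  note sk = Rm_skew[OF _ _ _ _ p]
  show ?thesis
    using bi[OF v(1,2,3,4)] bi[OF v(2,3,4,1)] bi[OF v(3,4,1,2)] bi[OF v(4,1,2,3)]
      sk[OF v(1,2,3,4)] sk[OF v(2,3,1,4)] sk[OF v(3,1,2,4)]
      sk[OF v(2,3,4,1)] sk[OF v(3,4,2,1)] sk[OF v(4,2,3,1)]
      sk[OF v(3,4,1,2)] sk[OF v(4,1,3,2)] sk[OF v(1,3,4,2)]
      sk[OF v(4,1,2,3)] sk[OF v(1,2,4,3)] sk[OF v(2,4,1,3)]
      anti[OF v(1,3,2,4)] anti[OF v(2,4,3,1)] anti[OF v(1,3,4,2)] anti[OF v(2,4,1,3)]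
    by linarith
qed

text \<open>
  The Jacobi identity for the operators \<open>D X\<close>, \<open>D Y\<close>, \<open>D Z\<close>, whose commutators are
  \<open>Rm X Y + D [X, Y]\<close>, combined with the Jacobi identity for the brackets.
\<close>

lemma Rm_bianchi2:
  assumes v: "vf X" "vf Y" "vf Z" "vf V" and p: "p \<in> W"
  shows "(D X (Rm Y Z V) p f - Rm Y Z (D X V) p f) + (D Y (Rm Z X V) p f - Rm Z X (D Y V) p f)
      + (D Z (Rm X Y V) p f - Rm X Y (D Z V) p f)
    = Rm (br X Y) Z V p f + Rm (br Y Z) X V p f + Rm (br Z X) Y V p f"
proof -
  note vI = v bracket_vf D_vf vf_intros
  have 1: "D P (Rm Q S V) p f = D P (D Q (D S V)) p f - D P (D S (D Q V)) p f - D P (D (br Q S) V) p f"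
    if "vf P" "vf Q" "vf S" for P Q S
  proof -
    note vI = vI that
    have "D P (Rm Q S V) p f = D P (\<lambda>p f. D Q (D S V) p f - D S (D Q V) p f) p f - D P (D (br Q S) V) p f"
      unfolding Rm_eq by (intro D_diff_right vI p)
    also have "D P (\<lambda>p f. D Q (D S V) p f - D S (D Q V) p f) p f
        = D P (D Q (D S V)) p f - D P (D S (D Q V)) p f"
      by (intro D_diff_right vI p)
    finally show ?thesis .
  qed
  have "D (\<lambda>q f. br (br X Y) Z q f + br (br Y Z) X q f + br (br Z X) Y q f) V p f = 0"
    by (subst D_vanish_left) (auto simp: bracket_jacobi v p)
  moreover have "D (\<lambda>q f. br (br X Y) Z q f + br (br Y Z) X q f + br (br Z X) Y q f) V p f
      = D (\<lambda>q f. br (br X Y) Z q f + br (br Y Z) X q f) V p f + D (br (br Z X) Y) V p f"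
    by (intro D_add_left vI p)
  moreover have "D (\<lambda>q f. br (br X Y) Z q f + br (br Y Z) X q f) V p f
      = D (br (br X Y) Z) V p f + D (br (br Y Z) X) V p f"
    by (intro D_add_left vI p)
  ultimately show ?thesis
    unfolding 1[OF v(1,2,3)] 1[OF v(2,3,1)] 1[OF v(3,1,2)]
    unfolding curvature_def by linarith
qed

end

section \<open>Traces over orthonormal frames\<close>

lemma orthogonal_sum:
  fixes a :: "'n::finite \<Rightarrow> 'n \<Rightarrow> real"
  assumes "\<And>i j. (\<Sum>k\<in>UNIV. a i k * a j k) = (if i = j then 1 else 0)"
  shows "(\<Sum>i\<in>UNIV. a i k * a i l) = (if k = l then 1 else 0)"
proof -
  define M where "M = (\<chi> i k. a i k)"
  have "M ** transpose M = mat 1"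
    by (simp add: vec_eq_iff matrix_matrix_mult_def transpose_def mat_def M_def assms)
  then have "transpose M ** M = mat 1" using matrix_left_right_inverse by blast
  then have "(transpose M ** M) $ k $ l = mat 1 $ k $ l" by simp
  then show ?thesis by (simp add: matrix_matrix_mult_def transpose_def mat_def M_def)
qed

text \<open>
  Orthonormality of the rows of a square matrix gives orthonormality of its columns, and with it the
  invariance of the trace of a bilinear form under a change of orthonormal basis.
\<close>

lemma orthogonal_trace:
  fixes a :: "'n::finite \<Rightarrow> 'n \<Rightarrow> real" and T :: "'n \<Rightarrow> 'n \<Rightarrow> real"
  assumes "\<And>i j. (\<Sum>k\<in>UNIV. a i k * a j k) = (if i = j then 1 else 0)"
  shows "(\<Sum>i\<in>UNIV. \<Sum>k\<in>UNIV. \<Sum>l\<in>UNIV. a i k * (a i l * T k l)) = (\<Sum>k\<in>UNIV. T k k)"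
proof -
  have "(\<Sum>i\<in>UNIV. \<Sum>k\<in>UNIV. \<Sum>l\<in>UNIV. a i k * (a i l * T k l))
      = (\<Sum>k\<in>UNIV. \<Sum>l\<in>UNIV. (\<Sum>i\<in>UNIV. a i k * a i l) * T k l)"
    unfolding sum_distrib_right mult.assoc
    by (subst sum.swap, subst (2) sum.swap) (rule refl)
  also have "\<dots> = (\<Sum>k\<in>UNIV. \<Sum>l\<in>UNIV. if k = l then T k l else 0)"
    unfolding orthogonal_sum[OF assms] by (intro sum.cong refl) auto
  finally show ?thesis by simp
qed

text \<open>
  Used for the derivative of a trace: a moving orthonormal frame turns by a skew-symmetric matrix, so
  the derivatives of the frame vectors contribute nothing.
\<close>

lemma skew_sum:
  fixes a F :: "'k \<Rightarrow> 'k \<Rightarrow> real"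
  assumes "\<And>i k. a i k = - a k i"
  shows "(\<Sum>i\<in>I. \<Sum>k\<in>I. a i k * (F k i + F i k)) = 0"
proof -
  have "(\<Sum>i\<in>I. \<Sum>k\<in>I. a i k * (F k i + F i k)) = (\<Sum>i\<in>I. \<Sum>k\<in>I. a k i * (F i k + F k i))"
    by (rule sum.swap)
  also have "\<dots> = (\<Sum>i\<in>I. \<Sum>k\<in>I. - (a i k * (F k i + F i k)))"
    by (intro sum.cong refl, subst assms) (simp add: algebra_simps)
  finally show ?thesis by (simp add: sum_negf)
qed

context riemannian_manifold
begin

text \<open>
  The last clause is Fourier expansion, included so that identities of tangent vectors can be tested on
  the frame without counting dimensions.
\<close>

definition orthonormal_frame :: "'m set \<Rightarrow> ('n \<Rightarrow> 'm field) \<Rightarrow> bool" where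
  "orthonormal_frame W B \<longleftrightarrow> (\<forall>i. vector_field A W (B i)) \<and>
     (\<forall>p\<in>W. \<forall>i j. g p (B i p) (B j p) = (if i = j then 1 else 0)) \<and>
     (\<forall>p\<in>W. \<forall>u\<in>tangent_space A p. u = (\<lambda>f. \<Sum>k\<in>UNIV. g p u (B k p) * B k p f))"

text \<open>
  The invariant of the Gram--Schmidt process after the coordinate directions in \<open>I\<close> have been treated.
  The third clause says that \<open>B i\<close> lies in the span of the coordinate fields in \<open>I\<close>, which keeps the
  next coordinate field independent of them; the fourth is the converse inclusion of spans, written
  with the Fourier coefficients.
\<close>

definition adapted_frame :: "('m, 'n) chart \<Rightarrow> 'n set \<Rightarrow> ('n \<Rightarrow> 'm field) \<Rightarrow> bool" where
  "adapted_frame C I B \<longleftrightarrow>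
     (\<forall>i\<in>I. vector_field A (fst C) (B i)) \<and>
     (\<forall>p\<in>fst C. \<forall>i\<in>I. \<forall>j\<in>I. g p (B i p) (B j p) = (if i = j then 1 else 0)) \<and>
     (\<forall>p\<in>fst C. \<forall>i\<in>I. \<exists>v. (\<forall>k. k \<notin> I \<longrightarrow> v $ k = 0) \<and> B i p = chart_vector A C p v) \<and>
     (\<forall>p\<in>fst C. \<forall>i\<in>I. chart_vector A C p (axis i 1) =
        (\<lambda>f. \<Sum>k\<in>I. g p (chart_vector A C p (axis i 1)) (B k p) * B k p f))"

lemma gram_schmidt:
  assumes c: "(U, c) \<in> A"
  shows "\<exists>B. adapted_frame (U, c) I B"
  using finite[of I]
proof (induction I rule: finite_induct)
  case empty
  then show ?case by (simp add: adapted_frame_def)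
next
  case (insert j I)
  define e where "e = (\<lambda>k p. chart_vector A (U, c) p (axis k 1))"
  obtain B where B: "adapted_frame (U, c) I B" using insert.IH ..
  note B' = B[unfolded adapted_frame_def fst_conv]
  have vB: "vector_field A U (B i)" if "i \<in> I" for i
    by (rule B'[THEN conjunct1, rule_format, OF that])
  have oB: "g p (B i p) (B k p) = (if i = k then 1 else 0)" if "p \<in> U" "i \<in> I" "k \<in> I" for p i k
    by (rule B'[THEN conjunct2, THEN conjunct1, rule_format, OF that])
  have sB: "\<exists>v. (\<forall>k. k \<notin> I \<longrightarrow> v $ k = 0) \<and> B i p = chart_vector A (U, c) p v"
    if "p \<in> U" "i \<in> I" for p i
    by (rule B'[THEN conjunct2, THEN conjunct2, THEN conjunct1, THEN bspec, THEN bspec, OF that])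
  have eB: "e i p = (\<lambda>f. \<Sum>k\<in>I. g p (e i p) (B k p) * B k p f)" if "p \<in> U" "i \<in> I" for p i
    unfolding e_def
    by (rule B'[THEN conjunct2, THEN conjunct2, THEN conjunct2, THEN bspec, THEN bspec, OF that])
  interpret local_fields A g D U
    by unfold_locales (rule chart_open[OF c])
  note t = vf_tangent
  have ve: "vf (e k)" for k unfolding e_def by (rule coordinate_field[OF c])
  define a where "a = (\<lambda>k q. g q (e j q) (B k q))"
  define S where "S = (\<lambda>q f. \<Sum>k\<in>I. a k q * B k q f)"
  \<comment> \<open>the component of the new coordinate field orthogonal to the fields found so far\<close>
  define Y where "Y = (\<lambda>q f. e j q f - S q f)"
  define s where "s = (\<lambda>q. g q (Y q) (Y q) powr (-1/2))"
  define C where "C = B(j := (\<lambda>q f. s q * Y q f))"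
  have va: "sm (a k)" if "k \<in> I" for k unfolding a_def by (intro g_smooth[OF W] ve vB that)
  have vS: "vf S" unfolding S_def by (intro vector_field_sum vf_intros va vB)
  have vY: "vf Y" unfolding Y_def by (intro vf_intros ve vS)
  have supp: "\<exists>w. (\<forall>k. k \<notin> I \<longrightarrow> w $ k = 0) \<and> Y q = chart_vector A (U, c) q (axis j 1 - w)"
    if q: "q \<in> U" for q
  proof -
    obtain v where v: "\<And>i. i \<in> I \<Longrightarrow> (\<forall>k. k \<notin> I \<longrightarrow> v i $ k = 0) \<and> B i q = chart_vector A (U, c) q (v i)"
      using sB[OF q] by metis
    define w where "w = (\<Sum>k\<in>I. a k q *\<^sub>R v k)"
    have 1: "S q = chart_vector A (U, c) q w"
      unfolding w_def S_def chart_vector_sum[OF c q] using v by auto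
    have "chart_vector A (U, c) q (axis j 1 - w) = Y q"
      using chart_vector_lincomb[OF c q, of "-1" w "axis j 1"]
      by (simp add: Y_def e_def 1 algebra_simps)
    moreover have "\<forall>k. k \<notin> I \<longrightarrow> w $ k = 0" using v by (simp add: w_def)
    ultimately show ?thesis by metis
  qed
  have pos: "g q (Y q) (Y q) > 0" if q: "q \<in> U" for q
  proof -
    obtain w where w: "\<forall>k. k \<notin> I \<longrightarrow> w $ k = 0" "Y q = chart_vector A (U, c) q (axis j 1 - w)"
      using supp[OF q] by blast
    \<comment> \<open>\<open>Y\<close> does not vanish: its \<open>j\<close>-th coordinate is 1, since \<open>S\<close> only involves directions in \<open>I\<close>\<close>
    have "Y q (\<lambda>q. c q $ j) = 1"
      using w insert.hyps by (simp add: chart_vector_coordinate[OF c q])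
    then show ?thesis by (intro g_pos t[OF vY q]) auto
  qed
  have ss: "s q * s q * g q (Y q) (Y q) = 1" if "q \<in> U" for q
    using pos[OF that] powr_minus_divide[of "g q (Y q) (Y q)" 1]
    by (simp add: s_def powr_add[symmetric])
  have sms: "sm s" unfolding s_def by (intro smooth_fun_powr[OF W] g_smooth[OF W] vY pos)
  have vCj: "vf (C j)" unfolding C_def using vf_intros(4)[OF vY sms] by simp
  have CI: "C i = B i" if "i \<in> I" for i using that insert.hyps by (auto simp: C_def)
  have vC: "vf (C i)" if "i \<in> insert j I" for i using that vCj vB CI by auto
  have gS: "g q (S q) (X q) = (\<Sum>l\<in>I. a l q * g q (B l q) (X q))" if "q \<in> U" "vf X" for q X
    unfolding S_def using that by (intro g_sum t vB)
  have YB: "g q (Y q) (B k q) = 0" if "q \<in> U" "k \<in> I" for q k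
  proof -
    have "g q (Y q) (B k q) = a k q - g q (S q) (B k q)"
      unfolding Y_def a_def using that by (intro g_diff t ve vS vB)
    also have "g q (S q) (B k q) = (\<Sum>l\<in>I. a l q * (if l = k then 1 else 0))"
      using gS[OF that(1) vB[OF that(2)]] oB[OF that(1) _ that(2)] by simp
    also have "(\<Sum>l\<in>I. a l q * (if l = k then 1 else 0)) = a k q"
      using that(2) insert.hyps(1) by (simp add: if_distrib[of "(*) _"] sum.delta cong: if_cong)
    finally show ?thesis by simp
  qed
  have CY: "g q (C j q) (X q) = s q * g q (Y q) (X q)" if "q \<in> U" "vf X" for q X
    unfolding C_def using g_scale[OF t[OF vY that(1)] t[OF that(2,1)]] by simp
  have CB: "g q (C j q) (B k q) = 0" "g q (B k q) (C j q) = 0" if "q \<in> U" "k \<in> I" for q k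
    using CY[OF that(1) vB[OF that(2)]] YB[OF that] g_sym[OF t[OF vCj that(1)] t[OF vB[OF that(2)] that(1)]]
    by simp_all
  have YC: "g q (Y q) (C j q) = s q * g q (Y q) (Y q)" if "q \<in> U" for q
    using CY[OF that vY] g_sym[OF t[OF vCj that] t[OF vY that]] by simp
  have CC: "g q (C j q) (C j q) = 1" if "q \<in> U" for q
    using CY[OF that vCj] YC[OF that] ss[OF that] by simp
  have o: "g q (C i q) (C k q) = (if i = k then 1 else 0)"
    if "q \<in> U" "i \<in> insert j I" "k \<in> insert j I" for q i k
    using that CI CC CB oB insert.hyps by auto
  have sp: "\<exists>v. (\<forall>k. k \<notin> insert j I \<longrightarrow> v $ k = 0) \<and> C i q = chart_vector A (U, c) q v"
    if q: "q \<in> U" and i: "i \<in> insert j I" for q i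
  proof (cases "i = j")
    case True
    obtain w where w: "\<forall>k. k \<notin> I \<longrightarrow> w $ k = 0" "Y q = chart_vector A (U, c) q (axis j 1 - w)"
      using supp[OF q] by blast
    have "C i q = chart_vector A (U, c) q (s q *\<^sub>R (axis j 1 - w))"
      using chart_vector_sum[OF c q, of "\<lambda>_. s q" "\<lambda>_. axis j 1 - w" "{j}"]
      by (simp add: C_def True w(2))
    then show ?thesis using w(1) by (intro exI[of _ "s q *\<^sub>R (axis j 1 - w)"]) (auto simp: axis_def)
  next
    case False
    then show ?thesis using q i sB CI by (metis insertCI insertE)
  qed
  have ex: "e i q = (\<lambda>f. \<Sum>k\<in>insert j I. g q (e i q) (C k q) * C k q f)"
    if q: "q \<in> U" and i: "i \<in> insert j I" for q i
  proof (cases "i = j")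
    case True
    have "g q (Y q) (C j q) = g q (e j q) (C j q) - g q (S q) (C j q)"
      unfolding Y_def by (intro g_diff t ve vS vCj q)
    moreover have "g q (S q) (C j q) = 0" using gS[OF q vCj] CB(2)[OF q] by simp
    ultimately have eC: "g q (e j q) (C j q) = s q * g q (Y q) (Y q)"
      using YC[OF q] by simp
    have "g q (e j q) (C j q) * C j q f = Y q f" for f
    proof -
      have "C j q f = s q * Y q f" by (simp add: C_def)
      then have "g q (e j q) (C j q) * C j q f = (s q * s q * g q (Y q) (Y q)) * Y q f"
        unfolding eC by (simp only: mult_ac)
      then show ?thesis unfolding ss[OF q] by simp
    qed
    moreover have "(\<Sum>k\<in>I. g q (e j q) (C k q) * C k q f) = S q f" for f
      by (simp add: CI S_def a_def)
    ultimately show ?thesis using insert.hyps True by (simp add: Y_def)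
  next
    case False
    then have iI: "i \<in> I" using i by simp
    have "g q (e i q) (C j q) = g q (\<lambda>f. \<Sum>k\<in>I. g q (e i q) (B k q) * B k q f) (C j q)"
      using eB[OF q iI] by simp
    also have "\<dots> = (\<Sum>k\<in>I. g q (e i q) (B k q) * g q (B k q) (C j q))"
      by (intro g_sum t vB vCj q)
    also have "\<dots> = 0" using CB(2)[OF q] by simp
    finally have 0: "g q (e i q) (C j q) = 0" .
    have "(\<lambda>f. \<Sum>k\<in>insert j I. g q (e i q) (C k q) * C k q f)
        = (\<lambda>f. \<Sum>k\<in>I. g q (e i q) (B k q) * B k q f)"
      using insert.hyps by (simp add: 0 CI)
    then show ?thesis using eB[OF q iI] by simp
  qed
  have "adapted_frame (U, c) (insert j I) C"
    unfolding adapted_frame_def fst_conv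
    using ex[unfolded e_def] by (intro conjI ballI vC o sp)
  then show ?case by blast
qed

lemma orthonormal_frame_exists:
  assumes c: "(U, c) \<in> A"
  shows "\<exists>B. orthonormal_frame U B"
proof -
  define e where "e = (\<lambda>k p. chart_vector A (U, c) p (axis k 1))"
  obtain B where B: "adapted_frame (U, c) UNIV B" using gram_schmidt[OF c] ..
  note B' = B[unfolded adapted_frame_def fst_conv]
  have vB: "vector_field A U (B i)" for i
    by (rule B'[THEN conjunct1, rule_format, OF UNIV_I])
  have oB: "g p (B i p) (B k p) = (if i = k then 1 else 0)" if "p \<in> U" for p i k
    by (rule B'[THEN conjunct2, THEN conjunct1, rule_format, OF that UNIV_I UNIV_I])
  have eB: "e i p = (\<lambda>f. \<Sum>k\<in>UNIV. g p (e i p) (B k p) * B k p f)" if "p \<in> U" for p i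
    unfolding e_def
    by (rule B'[THEN conjunct2, THEN conjunct2, THEN conjunct2, THEN bspec, THEN bspec, OF that UNIV_I])
  have "u = (\<lambda>f. \<Sum>k\<in>UNIV. g p u (B k p) * B k p f)" if p: "p \<in> U" and u: "u \<in> tangent_space A p" for p u
  proof -
    obtain v where v: "u = chart_vector A (U, c) p v" using tangent_space_chart[OF u c p] .
    have "v = (\<Sum>i\<in>UNIV. v $ i *\<^sub>R axis i 1)"
      using basis_expansion[of v] by (simp add: scalar_mult_eq_scaleR)
    then have ue: "u = (\<lambda>f. \<Sum>i\<in>UNIV. v $ i * e i p f)"
      unfolding v e_def using chart_vector_sum[OF c p, of "\<lambda>i. v $ i" "\<lambda>i. axis i 1" UNIV] by simp
    have te: "e i p \<in> tangent_space A p" for i unfolding e_def by (rule chart_vector_tangent[OF c p])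
    have gu: "g p u (B k p) = (\<Sum>i\<in>UNIV. v $ i * g p (e i p) (B k p))" for k
      unfolding ue by (intro g_sum te vector_field_tangent[OF vB p])
    show "u = (\<lambda>f. \<Sum>k\<in>UNIV. g p u (B k p) * B k p f)"
    proof
      fix f
      have "u f = (\<Sum>i\<in>UNIV. v $ i * e i p f)" by (rule fun_cong[OF ue])
      also have "\<dots> = (\<Sum>i\<in>UNIV. v $ i * (\<Sum>k\<in>UNIV. g p (e i p) (B k p) * B k p f))"
        by (intro sum.cong refl arg_cong[of _ _ "(*) _"] fun_cong[OF eB[OF p]])
      also have "\<dots> = (\<Sum>k\<in>UNIV. g p u (B k p) * B k p f)"
        unfolding gu sum_distrib_left sum_distrib_right by (subst sum.swap) (simp add: mult.assoc)
      finally show "u f = (\<Sum>k\<in>UNIV. g p u (B k p) * B k p f)" .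
    qed
  qed
  then have "orthonormal_frame U B"
    unfolding orthonormal_frame_def by (intro conjI allI ballI vB oB)
  then show ?thesis by blast
qed

lemma orthonormal_frame_subset: "orthonormal_frame U B \<Longrightarrow> W \<subseteq> U \<Longrightarrow> orthonormal_frame W B"
  unfolding orthonormal_frame_def using vector_field_subset by blast

end

context local_fields
begin

lemma Rm_zero:
  assumes "vf X" "vf Y" "p \<in> W"
  shows "Rm (\<lambda>q f. 0) X Y p f = 0" "Rm X (\<lambda>q f. 0) Y p f = 0" "Rm X Y (\<lambda>q f. 0) p f = 0"
  using Rm_lincomb_left[OF vector_field_zero vector_field_zero assms(1,2) smooth_fun_const[of W 1] assms(3)]
    Rm_lincomb_middle[OF vector_field_zero vector_field_zero assms(1,2) smooth_fun_const[of W 1] assms(3)]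
    Rm_lincomb_right[OF assms(1,2) vector_field_zero vector_field_zero smooth_fun_const[of W 1] assms(3)]
  by simp_all

lemma Rm_sum:
  assumes X: "\<And>k. k \<in> I \<Longrightarrow> vf (X k)" and h: "\<And>k. k \<in> I \<Longrightarrow> sm (h k)"
    and v: "vf Y" "vf Z" and p: "p \<in> W"
  shows "Rm (\<lambda>q f. \<Sum>k\<in>I. h k q * X k q f) Y Z p f = (\<Sum>k\<in>I. h k p * Rm (X k) Y Z p f)"
    and "Rm Y (\<lambda>q f. \<Sum>k\<in>I. h k q * X k q f) Z p f = (\<Sum>k\<in>I. h k p * Rm Y (X k) Z p f)"
    and "Rm Y Z (\<lambda>q f. \<Sum>k\<in>I. h k q * X k q f) p f = (\<Sum>k\<in>I. h k p * Rm Y Z (X k) p f)"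
proof -
  show "Rm (\<lambda>q f. \<Sum>k\<in>I. h k q * X k q f) Y Z p f = (\<Sum>k\<in>I. h k p * Rm (X k) Y Z p f)"
    using X h
  proof (induction I rule: infinite_finite_induct)
    case (insert k I)
    then have "vf (\<lambda>q f. \<Sum>k\<in>I. h k q * X k q f)" by (intro vector_field_sum vf_intros) auto
    with insert show ?case by (simp add: Rm_lincomb_left v p)
  qed (simp_all add: Rm_zero v p)
  show "Rm Y (\<lambda>q f. \<Sum>k\<in>I. h k q * X k q f) Z p f = (\<Sum>k\<in>I. h k p * Rm Y (X k) Z p f)"
    using X h
  proof (induction I rule: infinite_finite_induct)
    case (insert k I)
    then have "vf (\<lambda>q f. \<Sum>k\<in>I. h k q * X k q f)" by (intro vector_field_sum vf_intros) auto
    with insert show ?case by (simp add: Rm_lincomb_middle v p)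
  qed (simp_all add: Rm_zero v p)
  show "Rm Y Z (\<lambda>q f. \<Sum>k\<in>I. h k q * X k q f) p f = (\<Sum>k\<in>I. h k p * Rm Y Z (X k) p f)"
    using X h
  proof (induction I rule: infinite_finite_induct)
    case (insert k I)
    then have "vf (\<lambda>q f. \<Sum>k\<in>I. h k q * X k q f)" by (intro vector_field_sum vf_intros) auto
    with insert show ?case by (simp add: Rm_lincomb_right v p)
  qed (simp_all add: Rm_zero v p)
qed

end

locale framed = local_fields A g D W
  for A :: "('m::{t2_space,second_countable_topology}, 'n::finite) chart set" and g D W +
  fixes B :: "'n \<Rightarrow> 'm field"
  assumes frame: "orthonormal_frame W B"
begin

lemma B_vf [intro, simp]: "vf (B i)"
  and B_orthonormal: "p \<in> W \<Longrightarrow> g p (B i p) (B j p) = (if i = j then 1 else 0)"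
  and B_expand: "p \<in> W \<Longrightarrow> u \<in> tangent_space A p \<Longrightarrow> u = (\<lambda>f. \<Sum>k\<in>UNIV. g p u (B k p) * B k p f)"
  using frame unfolding orthonormal_frame_def by blast+

lemma tangent_eqI:
  assumes "p \<in> W" "u \<in> tangent_space A p" "v \<in> tangent_space A p" "\<And>k. g p u (B k p) = g p v (B k p)"
  shows "u = v"
  using B_expand[OF assms(1,2)] B_expand[OF assms(1,3)] assms(4) by simp

lemma g_expand:
  assumes "p \<in> W" "u \<in> tangent_space A p" "v \<in> tangent_space A p"
  shows "g p u v = (\<Sum>k\<in>UNIV. g p u (B k p) * g p v (B k p))"
proof -
  have "g p u v = g p (\<lambda>f. \<Sum>k\<in>UNIV. g p u (B k p) * B k p f) v"
    using B_expand[OF assms(1,2)] by simp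
  also have "\<dots> = (\<Sum>k\<in>UNIV. g p u (B k p) * g p (B k p) v)"
    by (intro g_sum vf_tangent[OF B_vf assms(1)] assms(3))
  finally show ?thesis using g_sym[OF assms(3) vf_tangent[OF B_vf assms(1)]] by simp
qed

lemma Rm_expand:
  assumes v: "vf X" "vf Y" "vf Z" "vf V" and p: "p \<in> W"
  shows "g p (Rm X Y Z p) (V p) = (\<Sum>k\<in>UNIV. g p (X p) (B k p) * g p (Rm (B k) Y Z p) (V p))"
    and "g p (Rm X Y Z p) (V p) = (\<Sum>k\<in>UNIV. g p (Y p) (B k p) * g p (Rm X (B k) Z p) (V p))"
    and "g p (Rm X Y Z p) (V p) = (\<Sum>k\<in>UNIV. g p (Z p) (B k p) * g p (Rm X Y (B k) p) (V p))"
    and "g p (Rm X Y Z p) (V p) = (\<Sum>k\<in>UNIV. g p (V p) (B k p) * g p (Rm X Y Z p) (B k p))"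
proof -
  note t = vf_tangent[OF _ p]
  have e: "T q = (\<lambda>f. \<Sum>k\<in>UNIV. g q (T q) (B k q) * B k q f)" if "vf T" "q \<in> W" for T q
    by (rule B_expand[OF that(2) vf_tangent[OF that]])
  have s: "sm (\<lambda>q. g q (T q) (B k q))" if "vf T" for T k using that by (intro g_smooth[OF W]) auto
  have "Rm X Y Z p = (\<lambda>f. \<Sum>k\<in>UNIV. g p (X p) (B k p) * Rm (B k) Y Z p f)"
  proof
    fix f
    have "Rm X Y Z p f = Rm (\<lambda>q f. \<Sum>k\<in>UNIV. g q (X q) (B k q) * B k q f) Y Z p f"
      by (rule fun_cong[OF Rm_cong[OF v(1,2,3) e[OF v(1)] refl refl p]])
    also have "\<dots> = (\<Sum>k\<in>UNIV. g p (X p) (B k p) * Rm (B k) Y Z p f)"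
      by (rule Rm_sum(1)[OF B_vf s[OF v(1)] v(2) v(3) p])
    finally show "Rm X Y Z p f = (\<Sum>k\<in>UNIV. g p (X p) (B k p) * Rm (B k) Y Z p f)" .
  qed
  then show "g p (Rm X Y Z p) (V p) = (\<Sum>k\<in>UNIV. g p (X p) (B k p) * g p (Rm (B k) Y Z p) (V p))"
    using g_sum[OF t[OF Rm_vf[OF B_vf v(2) v(3)]] t[OF v(4)], where I = UNIV and a = "\<lambda>k. g p (X p) (B k p)"]
    by simp
  have "Rm X Y Z p = (\<lambda>f. \<Sum>k\<in>UNIV. g p (Y p) (B k p) * Rm X (B k) Z p f)"
  proof
    fix f
    have "Rm X Y Z p f = Rm X (\<lambda>q f. \<Sum>k\<in>UNIV. g q (Y q) (B k q) * B k q f) Z p f"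
      by (rule fun_cong[OF Rm_cong[OF v(1,2,3) refl e[OF v(2)] refl p]])
    also have "\<dots> = (\<Sum>k\<in>UNIV. g p (Y p) (B k p) * Rm X (B k) Z p f)"
      by (rule Rm_sum(2)[OF B_vf s[OF v(2)] v(1) v(3) p])
    finally show "Rm X Y Z p f = (\<Sum>k\<in>UNIV. g p (Y p) (B k p) * Rm X (B k) Z p f)" .
  qed
  then show "g p (Rm X Y Z p) (V p) = (\<Sum>k\<in>UNIV. g p (Y p) (B k p) * g p (Rm X (B k) Z p) (V p))"
    using g_sum[OF t[OF Rm_vf[OF v(1) B_vf v(3)]] t[OF v(4)], where I = UNIV and a = "\<lambda>k. g p (Y p) (B k p)"]
    by simp
  have "Rm X Y Z p = (\<lambda>f. \<Sum>k\<in>UNIV. g p (Z p) (B k p) * Rm X Y (B k) p f)"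
  proof
    fix f
    have "Rm X Y Z p f = Rm X Y (\<lambda>q f. \<Sum>k\<in>UNIV. g q (Z q) (B k q) * B k q f) p f"
      by (rule fun_cong[OF Rm_cong[OF v(1,2,3) refl refl e[OF v(3)] p]])
    also have "\<dots> = (\<Sum>k\<in>UNIV. g p (Z p) (B k p) * Rm X Y (B k) p f)"
      by (rule Rm_sum(3)[OF B_vf s[OF v(3)] v(1) v(2) p])
    finally show "Rm X Y Z p f = (\<Sum>k\<in>UNIV. g p (Z p) (B k p) * Rm X Y (B k) p f)" .
  qed
  then show "g p (Rm X Y Z p) (V p) = (\<Sum>k\<in>UNIV. g p (Z p) (B k p) * g p (Rm X Y (B k) p) (V p))"
    using g_sum[OF t[OF Rm_vf[OF v(1) v(2) B_vf]] t[OF v(4)], where I = UNIV and a = "\<lambda>k. g p (Z p) (B k p)"]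
    by simp
  show "g p (Rm X Y Z p) (V p) = (\<Sum>k\<in>UNIV. g p (V p) (B k p) * g p (Rm X Y Z p) (B k p))"
    using g_expand[OF p t t, of "Rm X Y Z" V] v by (auto simp: mult.commute)
qed

text \<open>
  Both sides are the full trace of the same tensor at \<open>p\<close>: the values \<open>E i p\<close> arise from \<open>B i p\<close> by an
  orthogonal matrix, and the trace is invariant first in the pair \<open>i\<close> and then in the pair \<open>j\<close>.
\<close>

lemma curvature_trace_frame:
  fixes E :: "'n \<Rightarrow> 'm field"
  assumes E: "\<And>i. vf (E i)" and p: "p \<in> W"
    and o: "\<And>i j. g p (E i p) (E j p) = (if i = j then 1 else 0)"
  shows "(\<Sum>j\<in>UNIV. \<Sum>i\<in>UNIV. g p (Rm (E i) (E j) (E j) p) (E i p))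
    = (\<Sum>j\<in>UNIV. \<Sum>i\<in>UNIV. g p (Rm (B i) (B j) (B j) p) (B i p))"
proof -
  define a where "a = (\<lambda>i k. g p (E i p) (B k p))"
  have a: "(\<Sum>k\<in>UNIV. a i k * a j k) = (if i = j then 1 else 0)" for i j
    using g_expand[OF p vf_tangent[OF E p] vf_tangent[OF E p], of i j] o by (simp add: a_def)
  have 1: "(\<Sum>i\<in>UNIV. g p (Rm (E i) Y Z p) (E i p)) = (\<Sum>i\<in>UNIV. g p (Rm (B i) Y Z p) (B i p))"
    if "vf Y" "vf Z" for Y Z
  proof -
    have "g p (Rm (E i) Y Z p) (E i p) = (\<Sum>k\<in>UNIV. \<Sum>l\<in>UNIV. a i k * (a i l * g p (Rm (B k) Y Z p) (B l p)))" for i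
      using Rm_expand(1)[OF E that E p, of i i] Rm_expand(4)[OF B_vf that E p, of _ i]
      by (simp add: a_def sum_distrib_left)
    then show ?thesis using orthogonal_trace[OF a, of "\<lambda>k l. g p (Rm (B k) Y Z p) (B l p)"] by simp
  qed
  have 2: "(\<Sum>j\<in>UNIV. g p (Rm X (E j) (E j) p) (V p)) = (\<Sum>j\<in>UNIV. g p (Rm X (B j) (B j) p) (V p))"
    if "vf X" "vf V" for X V
  proof -
    have "g p (Rm X (E j) (E j) p) (V p) = (\<Sum>k\<in>UNIV. \<Sum>l\<in>UNIV. a j k * (a j l * g p (Rm X (B k) (B l) p) (V p)))" for j
      using Rm_expand(2)[OF that(1) E E that(2) p, of j j] Rm_expand(3)[OF that(1) B_vf E that(2) p, of _ j]
      by (simp add: a_def sum_distrib_left)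
    then show ?thesis using orthogonal_trace[OF a, of "\<lambda>k l. g p (Rm X (B k) (B l) p) (V p)"] by simp
  qed
  have "(\<Sum>j\<in>UNIV. \<Sum>i\<in>UNIV. g p (Rm (E i) (E j) (E j) p) (E i p))
      = (\<Sum>j\<in>UNIV. \<Sum>i\<in>UNIV. g p (Rm (B i) (E j) (E j) p) (B i p))"
    using 1 E by simp
  also have "\<dots> = (\<Sum>i\<in>UNIV. \<Sum>j\<in>UNIV. g p (Rm (B i) (E j) (E j) p) (B i p))"
    by (rule sum.swap)
  also have "\<dots> = (\<Sum>i\<in>UNIV. \<Sum>j\<in>UNIV. g p (Rm (B i) (B j) (B j) p) (B i p))"
    using 2 by simp
  finally show ?thesis by (subst (asm) (2) sum.swap)
qed

text \<open>
  Any competing frame in the definition lives on some other neighbourhood of \<open>p\<close>; on the intersection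
  of the two domains the traces agree, so the description is unique.
\<close>

lemma scalar_curvature_frame:
  assumes p: "p \<in> W"
  shows "scalar_curvature A g D p = (\<Sum>j\<in>UNIV. \<Sum>i\<in>UNIV. g p (Rm (B i) (B j) (B j) p) (B i p))"
  unfolding scalar_curvature_def
proof (rule the_equality)
  show "\<exists>W (E :: 'n \<Rightarrow> 'm field). open W \<and> p \<in> W \<and> (\<forall>i. vector_field A W (E i)) \<and>
        (\<forall>i j. g p (E i p) (E j p) = (if i = j then 1 else 0)) \<and>
        (\<Sum>j\<in>UNIV. \<Sum>i\<in>UNIV. g p (Rm (B i) (B j) (B j) p) (B i p))
          = (\<Sum>j\<in>UNIV. \<Sum>i\<in>UNIV. g p (curvature A D (E i) (E j) (E j) p) (E i p))"
    using W p B_orthonormal by (intro exI[of _ W] exI[of _ B]) auto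
next
  fix r
  assume "\<exists>W (E :: 'n \<Rightarrow> 'm field). open W \<and> p \<in> W \<and> (\<forall>i. vector_field A W (E i)) \<and>
        (\<forall>i j. g p (E i p) (E j p) = (if i = j then 1 else 0)) \<and>
        r = (\<Sum>j\<in>UNIV. \<Sum>i\<in>UNIV. g p (curvature A D (E i) (E j) (E j) p) (E i p))"
  then obtain W' and E :: "'n \<Rightarrow> 'm field" where E: "open W'" "p \<in> W'" "\<And>i. vector_field A W' (E i)"
    "\<And>i j. g p (E i p) (E j p) = (if i = j then 1 else 0)"
    and r: "r = (\<Sum>j\<in>UNIV. \<Sum>i\<in>UNIV. g p (curvature A D (E i) (E j) (E j) p) (E i p))"
    by blast
  interpret V: framed A g D "W \<inter> W'" B
    by unfold_locales (use W E(1) frame orthonormal_frame_subset in auto)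
  show "r = (\<Sum>j\<in>UNIV. \<Sum>i\<in>UNIV. g p (Rm (B i) (B j) (B j) p) (B i p))"
    unfolding r using E p by (intro V.curvature_trace_frame) (auto intro: vector_field_subset)
qed

end

section \<open>The soliton equation and the dual form\<close>

text \<open>
  The hypotheses of the theorem, with the condition on the length of \<open>\<xi>\<close> freed of square roots.
\<close>

locale yamabe = riemannian_manifold A g D
  for A :: "('m::{t2_space,second_countable_topology}, 'n::finite) chart set" and g D +
  fixes \<xi> :: "'m field" and l :: real and \<phi> :: "'m \<Rightarrow> 'm tangent \<Rightarrow> 'm tangent"
  assumes soliton: "yamabe_soliton A g D \<xi> l"
    and associated: "associated_tensor A g \<xi> \<phi>"
    and analytic: "phi_analytic A \<xi> \<phi>"
    and norm_xi: "g p (\<xi> p) (\<xi> p) = 2 * scalar_curvature A g D p"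
    and scalar_pos: "scalar_curvature A g D p > 0"
begin

definition \<rho> :: "'m \<Rightarrow> real" where "\<rho> p = scalar_curvature A g D p - l"
abbreviation \<eta> :: "'m field \<Rightarrow> 'm \<Rightarrow> real" where "\<eta> X q \<equiv> g q (X q) (\<xi> q)"
abbreviation \<Phi> :: "'m field \<Rightarrow> 'm field \<Rightarrow> 'm \<Rightarrow> real" where "\<Phi> X Y q \<equiv> g q (\<phi> q (X q)) (Y q)"

lemma xi_field: "vector_field A W \<xi>"
  using soliton vector_field_subset unfolding yamabe_soliton_def by blast

lemma eta_xi: "\<eta> \<xi> p = 2 * (\<rho> p + l)"
  by (simp add: \<rho>_def norm_xi)

lemma eta_xi_pos: "\<eta> \<xi> p > 0"
  using scalar_pos by (simp add: norm_xi)

end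

locale yamabe_local = yamabe A g D \<xi> l \<phi> + local_fields A g D W
  for A :: "('m::{t2_space,second_countable_topology}, 'n::finite) chart set" and g D \<xi> l \<phi> W
begin

lemma xi_vf [simp, intro]: "vf \<xi>" by (rule xi_field)

lemma eta_sm: "vf X \<Longrightarrow> sm (\<eta> X)" by (intro g_smooth[OF W] xi_vf)

text \<open>
  Smoothness of the scalar curvature comes for free from \<open>R = |\<xi>|\<^sup>2 / 2\<close>.
\<close>

lemma rho_sm: "sm \<rho>"
proof -
  have "sm (\<lambda>q. 1/2 * \<eta> \<xi> q - l)" by (intro sm_intros xi_vf)
  moreover have "(\<lambda>q. 1/2 * \<eta> \<xi> q - l) = \<rho>" by (simp add: \<rho>_def norm_xi fun_eq_iff)
  ultimately show ?thesis by simp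
qed

lemma phi_vf: "vf X \<Longrightarrow> vf (\<lambda>q. \<phi> q (X q))"
  using associated[unfolded associated_tensor_def tensor_field_11_def, THEN conjunct1, THEN conjunct2] W
  by simp

lemma bracket_self: "br X X p = (\<lambda>f. 0)"
  by (simp add: lie_bracket_def fun_eq_iff)

lemma g_zero_right: "p \<in> W \<Longrightarrow> vf X \<Longrightarrow> g p (X p) (\<lambda>f. 0) = 0"
  using g_sym[OF vf_tangent tangent_zero] g_zero[OF vf_tangent] by metis

lemma lie_metric:
  assumes "vf X" "vf Y" "p \<in> W"
  shows "\<xi> p (\<lambda>q. g q (X q) (Y q)) =
    g p (br \<xi> X p) (Y p) + g p (X p) (br \<xi> Y p) + 2 * \<rho> p * g p (X p) (Y p)"
proof -
  have "1 / 2 * lie_derivative_metric A \<xi> g X Y p = \<rho> p * g p (X p) (Y p)"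
    using soliton[unfolded yamabe_soliton_def] assms W by (simp add: \<rho>_def)
  then show ?thesis by (simp add: lie_derivative_metric_def)
qed

lemma lie_eta:
  assumes "vf X" "p \<in> W"
  shows "\<xi> p (\<eta> X) = \<eta> (br \<xi> X) p + 2 * \<rho> p * \<eta> X p"
  using lie_metric[OF assms(1) xi_vf assms(2)] by (simp add: bracket_self g_zero_right assms)

lemma d_eta:
  assumes "vf X" "vf Y" "p \<in> W"
  shows "2 * \<Phi> X Y p = X p (\<eta> Y) - Y p (\<eta> X) - \<eta> (br X Y) p"
proof -
  have "1 / 2 * exterior_derivative A (dual_form g \<xi>) X Y p = \<Phi> X Y p"
    using associated[unfolded associated_tensor_def, THEN conjunct2, THEN conjunct2] assms W by simp
  then show ?thesis by (simp add: exterior_derivative_def dual_form_def[abs_def])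
qed

text \<open>
  Since \<open>L\<^sub>\<xi> g = 2 \<rho> g\<close> and \<open>L\<^sub>\<xi> \<phi> = 0\<close>, the two-form \<open>\<Phi> = g(\<phi> \<sqdot>, \<sqdot>)\<close> satisfies \<open>L\<^sub>\<xi> \<Phi> = 2 \<rho> \<Phi>\<close>.
\<close>

lemma lie_Phi:
  assumes "vf X" "vf Y" "p \<in> W"
  shows "\<xi> p (\<Phi> X Y) = \<Phi> (br \<xi> X) Y p + \<Phi> X (br \<xi> Y) p + 2 * \<rho> p * \<Phi> X Y p"
proof -
  have "lie_derivative_11 A \<xi> \<phi> X p = (\<lambda>f. 0)"
    using analytic[unfolded phi_analytic_def] assms W by simp
  then have "br \<xi> (\<lambda>q. \<phi> q (X q)) p = \<phi> p (br \<xi> X p)"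
    by (simp add: lie_derivative_11_def fun_eq_iff)
  then show ?thesis using lie_metric[OF phi_vf[OF assms(1)] assms(2,3)] by simp
qed

text \<open>
  \<open>L\<^sub>\<xi> d\<eta>\<close> computed in two ways.  The Lie derivative commutes with \<open>d\<close>, so that \<open>L\<^sub>\<xi> \<eta> = 2 \<rho> \<eta>\<close> gives
  \<open>2 d\<rho> \<and> \<eta> + 2 \<rho> d\<eta>\<close>, while \<open>lie_Phi\<close> gives \<open>2 \<rho> d\<eta>\<close>.  The commutation is unfolded here on two
  fields and rests on the Jacobi identity for \<open>\<xi>\<close>, \<open>X\<close>, \<open>Y\<close>.
\<close>

lemma d_rho_wedge_eta:
  assumes v: "vf X" "vf Y" and p: "p \<in> W"
  shows "X p \<rho> * \<eta> Y p = Y p \<rho> * \<eta> X p"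
proof -
  \<comment> \<open>commuting \<open>\<xi>\<close> past another field and then using \<open>L\<^sub>\<xi> \<eta> = 2 \<rho> \<eta>\<close>\<close>
  have sw: "\<xi> p (\<lambda>q. P q (\<eta> Q)) = br \<xi> P p (\<eta> Q) + P p (\<eta> (br \<xi> Q))
      + 2 * (P p \<rho> * \<eta> Q p + \<rho> p * P p (\<eta> Q))" if "vf P" "vf Q" for P Q
  proof -
    have "br \<xi> P p (\<eta> Q) = \<xi> p (\<lambda>q. P q (\<eta> Q)) - P p (\<lambda>q. \<xi> q (\<eta> Q))"
      by (rule bracket_apply[OF p eta_sm[OF that(2)]])
    moreover have "P p (\<lambda>q. \<xi> q (\<eta> Q)) = P p (\<lambda>q. \<eta> (br \<xi> Q) q + 2 * (\<rho> q * \<eta> Q q))"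
      by (rule deriv_cong[OF that(1) p]) (use lie_eta[OF that(2)] in simp)
    moreover have "\<dots> = P p (\<eta> (br \<xi> Q)) + P p (\<lambda>q. 2 * (\<rho> q * \<eta> Q q))"
      by (intro deriv_add that p eta_sm bracket_vf xi_vf sm_intros rho_sm)
    moreover have "P p (\<lambda>q. 2 * (\<rho> q * \<eta> Q q)) = 2 * P p (\<lambda>q. \<rho> q * \<eta> Q q)"
      by (intro deriv_cmult that p sm_intros rho_sm xi_vf)
    moreover have "P p (\<lambda>q. \<rho> q * \<eta> Q q) = \<rho> p * P p (\<eta> Q) + P p \<rho> * \<eta> Q p"
      by (intro deriv_mult that p rho_sm eta_sm)
    ultimately show ?thesis by simp
  qed
  have sX: "sm (\<lambda>q. X q (\<eta> Y))" "sm (\<lambda>q. Y q (\<eta> X))"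
    by (rule deriv_sm; simp add: v eta_sm)+
  have "\<xi> p (\<lambda>q. 2 * \<Phi> X Y q) = \<xi> p (\<lambda>q. X q (\<eta> Y) - Y q (\<eta> X) - \<eta> (br X Y) q)"
    by (rule deriv_cong[OF xi_vf p d_eta[OF v]])
  also have "\<dots> = \<xi> p (\<lambda>q. X q (\<eta> Y) - Y q (\<eta> X)) - \<xi> p (\<eta> (br X Y))"
    by (intro deriv_diff xi_vf p eta_sm bracket_vf v smooth_fun_diff[OF W] sX)
  also have "\<xi> p (\<lambda>q. X q (\<eta> Y) - Y q (\<eta> X)) = \<xi> p (\<lambda>q. X q (\<eta> Y)) - \<xi> p (\<lambda>q. Y q (\<eta> X))"
    by (rule deriv_diff[OF xi_vf p sX])
  also have "\<xi> p (\<lambda>q. 2 * \<Phi> X Y q) = 2 * \<xi> p (\<Phi> X Y)"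
    by (intro deriv_cmult xi_vf p g_smooth[OF W] phi_vf v)
  finally have 1: "2 * \<xi> p (\<Phi> X Y) = \<xi> p (\<lambda>q. X q (\<eta> Y)) - \<xi> p (\<lambda>q. Y q (\<eta> X)) - \<xi> p (\<eta> (br X Y))" .
  have "br \<xi> (br X Y) p = (\<lambda>f. br (br \<xi> X) Y p f + br X (br \<xi> Y) p f)"
    using bracket_jacobi_derivation[OF xi_vf v p] by (simp add: fun_eq_iff)
  moreover have "g p (\<lambda>f. br (br \<xi> X) Y p f + br X (br \<xi> Y) p f) (\<xi> p)
      = \<eta> (br (br \<xi> X) Y) p + \<eta> (br X (br \<xi> Y)) p"
    by (intro g_add vf_tangent[OF _ p] bracket_vf v xi_vf)
  ultimately have 2: "\<eta> (br \<xi> (br X Y)) p = \<eta> (br (br \<xi> X) Y) p + \<eta> (br X (br \<xi> Y)) p"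
    by simp
  have "\<rho> p * (2 * \<Phi> X Y p) = \<rho> p * (X p (\<eta> Y) - Y p (\<eta> X) - \<eta> (br X Y) p)"
    by (simp only: d_eta[OF v p])
  then have 3: "2 * (\<rho> p * \<Phi> X Y p) = \<rho> p * X p (\<eta> Y) - \<rho> p * Y p (\<eta> X) - \<rho> p * \<eta> (br X Y) p"
    by (simp only: right_diff_distrib mult.left_commute)
  have "2 * (Y p \<rho> * \<eta> X p) + 2 * (\<rho> p * Y p (\<eta> X)) + 2 * (\<rho> p * \<eta> (br X Y) p) + 4 * (\<rho> p * \<Phi> X Y p)
      = 2 * (X p \<rho> * \<eta> Y p) + 2 * (\<rho> p * X p (\<eta> Y))"
    using 1 2 sw[OF v] sw[OF v(2,1)] lie_eta[OF bracket_vf[OF v] p] lie_Phi[OF v p]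
      d_eta[OF v p] d_eta[OF bracket_vf[OF xi_vf v(1)] v(2) p] d_eta[OF v(1) bracket_vf[OF xi_vf v(2)] p]
    by (simp add: algebra_simps)
  then show ?thesis using 3 by linarith
qed

text \<open>
  \<open>\<xi>\<close> commutes with itself, so \<open>L\<^sub>\<xi> \<eta> = 2 \<rho> \<eta>\<close> evaluated at \<open>\<xi>\<close> is a formula for \<open>\<xi> (|\<xi>|\<^sup>2) = 2 \<xi> R\<close>.
\<close>

lemma xi_rho:
  assumes p: "p \<in> W"
  shows "\<xi> p \<rho> = \<rho> p * \<eta> \<xi> p"
proof -
  have "\<xi> p (\<eta> \<xi>) = \<xi> p (\<lambda>q. 2 * (\<rho> q + l))" by (simp add: eta_xi)
  also have "\<dots> = 2 * (\<xi> p \<rho> + \<xi> p (\<lambda>q. l))"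
    using deriv_cmult[OF xi_vf p, of "\<lambda>q. \<rho> q + l" 2] deriv_add[OF xi_vf p rho_sm, of "\<lambda>q. l"]
    by (simp add: sm_intros rho_sm)
  also have "\<xi> p (\<lambda>q. l) = 0" by (rule deriv_const[OF xi_vf p])
  finally show ?thesis
    using lie_eta[OF xi_vf p] g_zero[OF vf_tangent[OF xi_vf p]] by (simp add: bracket_self)
qed

text \<open>
  Insert \<open>Y = \<xi>\<close> into \<open>d\<rho> \<and> \<eta> = 0\<close>, use the formula for \<open>\<xi> \<rho>\<close> and cancel \<open>|\<xi>|\<^sup>2 > 0\<close>.
\<close>

lemma d_rho:
  assumes "vf X" and p: "p \<in> W"
  shows "X p \<rho> = \<rho> p * \<eta> X p"
proof -
  have "X p \<rho> * \<eta> \<xi> p = (\<rho> p * \<eta> X p) * \<eta> \<xi> p"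
    using d_rho_wedge_eta[OF assms(1) xi_vf p] xi_rho[OF p] by simp
  then show ?thesis using eta_xi_pos[of p] by simp
qed

text \<open>
  Take the exterior derivative of \<open>d\<rho> = \<rho> \<eta>\<close>: it gives \<open>0 = d\<rho> \<and> \<eta> + \<rho> d\<eta>\<close>, and the first summand is
  \<open>\<rho> \<eta> \<and> \<eta> = 0\<close>.
\<close>

lemma rho_Phi:
  assumes v: "vf X" "vf Y" and p: "p \<in> W"
  shows "\<rho> p * \<Phi> X Y p = 0"
proof -
  have 1: "P p (\<lambda>q. Q q \<rho>) = \<rho> p * P p (\<eta> Q) + \<rho> p * \<eta> P p * \<eta> Q p" if "vf P" "vf Q" for P Q
  proof -
    have "P p (\<lambda>q. Q q \<rho>) = P p (\<lambda>q. \<rho> q * \<eta> Q q)"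
      by (rule deriv_cong[OF that(1) p d_rho[OF that(2)]])
    also have "\<dots> = \<rho> p * P p (\<eta> Q) + P p \<rho> * \<eta> Q p"
      by (intro deriv_mult that p rho_sm eta_sm)
    finally show ?thesis using d_rho[OF that(1) p] by simp
  qed
  have "\<rho> p * \<eta> (br X Y) p = \<rho> p * X p (\<eta> Y) - \<rho> p * Y p (\<eta> X)"
    using bracket_apply[OF p rho_sm, of X Y] d_rho[OF bracket_vf[OF v] p] 1[OF v] 1[OF v(2,1)]
    by (simp add: algebra_simps)
  then have "\<rho> p * (2 * \<Phi> X Y p) = 0" unfolding d_eta[OF v p] by (simp add: algebra_simps)
  then show ?thesis by simp
qed

text \<open>
  In general \<open>\<nabla>\<^sub>X \<xi> = \<rho> X + \<phi> X\<close>: the symmetric part of \<open>\<nabla>\<xi>\<close> is half of \<open>L\<^sub>\<xi> g\<close> and its skew part is half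
  of \<open>d\<eta>\<close>.  Where \<open>\<rho> \<noteq> 0\<close> the skew part vanishes.
\<close>

lemma g_D_xi:
  assumes v: "vf X" "vf Y" and p: "p \<in> W" and nz: "\<rho> p \<noteq> 0"
  shows "g p (D X \<xi> p) (Y p) = \<rho> p * g p (X p) (Y p)"
proof -
  note t = vf_tangent[OF _ p]
  have sym: "g p (P p) (Q p) = g p (Q p) (P p)" if "vf P" "vf Q" for P Q
    using g_sym[OF t[OF that(1)] t[OF that(2)]] .
  have b: "g p (br P Q p) (S p) = g p (D P Q p) (S p) - g p (D Q P p) (S p)"
    if "vf P" "vf Q" "vf S" for P Q S
  proof -
    have "br P Q p = (\<lambda>f. D P Q p f - D Q P p f)"
      using D_torsion[OF that(1,2) p] by (simp add: fun_eq_iff)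
    then show ?thesis using g_diff[OF t[OF D_vf[OF that(1,2)]] t[OF D_vf[OF that(2,1)]] t[OF that(3)]] by simp
  qed
  have \<Phi>0: "\<Phi> X Y p = 0" using rho_Phi[OF v p] nz by simp
  have "g p (X p) (br \<xi> Y p) = g p (br \<xi> Y p) (X p)" "g p (X p) (D \<xi> Y p) = g p (D \<xi> Y p) (X p)"
    "g p (Y p) (D X \<xi> p) = g p (D X \<xi> p) (Y p)" "g p (X p) (D Y \<xi> p) = g p (D Y \<xi> p) (X p)"
    by (intro sym bracket_vf D_vf v xi_vf)+
  then show ?thesis
    using lie_metric[OF v p] D_metric[OF xi_vf v p] b[OF xi_vf v] b[OF xi_vf v(2,1)]
      d_eta[OF v p] D_metric[OF v(1,2) xi_vf p] D_metric[OF v(2,1) xi_vf p] b[OF v xi_vf] \<Phi>0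
    by simp
qed

end

section \<open>Curvature of the soliton where the scalar curvature differs from \<open>\<lambda>\<close>\<close>

locale yamabe_framed = yamabe_local A g D \<xi> l \<phi> W + framed A g D W B
  for A :: "('m::{t2_space,second_countable_topology}, 'n::finite) chart set" and g D \<xi> l \<phi> W B +
  assumes rho_nonzero: "p \<in> W \<Longrightarrow> \<rho> p \<noteq> 0"
begin

lemma D_xi:
  assumes "vf X" "p \<in> W"
  shows "D X \<xi> p = (\<lambda>f. \<rho> p * X p f)"
proof (rule tangent_eqI[OF assms(2)])
  show "D X \<xi> p \<in> tangent_space A p" using vf_tangent assms by blast
  show "(\<lambda>f. \<rho> p * X p f) \<in> tangent_space A p" by (intro tangent_scale vf_tangent assms)
  show "g p (D X \<xi> p) (B k p) = g p (\<lambda>f. \<rho> p * X p f) (B k p)" for k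
    using g_D_xi[OF assms(1) B_vf assms(2) rho_nonzero[OF assms(2)], of k]
      g_scale[OF vf_tangent[OF assms] vf_tangent[OF B_vf assms(2)]] by simp
qed

text \<open>
  Commute covariant derivatives in \<open>\<nabla>\<xi> = \<rho> id\<close>: the result is \<open>(X \<rho>) Y - (Y \<rho>) X\<close>, and \<open>d\<rho> = \<rho> \<eta>\<close>.
\<close>

lemma Rm_on_xi:
  assumes v: "vf X" "vf Y" and p: "p \<in> W"
  shows "Rm X Y \<xi> p f = \<rho> p * (\<eta> X p * Y p f - \<eta> Y p * X p f)"
proof -
  have 1: "D P (D Q \<xi>) p f = \<rho> p * \<eta> P p * Q p f + \<rho> p * D P Q p f" if "vf P" "vf Q" for P Q
  proof -
    have "D P (D Q \<xi>) p = D P (\<lambda>q f. \<rho> q * Q q f) p"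
      by (rule D_cong[OF that(1) D_vf[OF that(2) xi_vf] refl D_xi[OF that(2)] p])
    then have "D P (D Q \<xi>) p f = D P (\<lambda>q f. \<rho> q * Q q f) p f" by (rule fun_cong)
    also have "\<dots> = P p \<rho> * Q p f + \<rho> p * D P Q p f"
      by (intro D_scale_right that rho_sm p)
    finally show ?thesis using d_rho[OF that(1) p] by simp
  qed
  show ?thesis
    unfolding curvature_def 1[OF v] 1[OF v(2,1)] D_xi[OF bracket_vf[OF v] p] D_torsion[OF v p]
    by (simp add: algebra_simps)
qed

lemma g_Rm_xi:
  assumes v: "vf X" "vf Y" "vf Z" and p: "p \<in> W"
  shows "g p (Rm \<xi> X Y p) (Z p) = \<rho> p * (\<eta> Y p * g p (X p) (Z p) - \<eta> Z p * g p (X p) (Y p))"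
proof -
  note t = vf_tangent[OF _ p]
  have "g p (Rm \<xi> X Y p) (Z p) = g p (Rm Y Z \<xi> p) (X p)"
    by (rule Rm_pair_symmetry[OF xi_vf v p])
  also have "Rm Y Z \<xi> p = (\<lambda>f. (\<rho> p * \<eta> Y p) * Z p f + (- \<rho> p * \<eta> Z p) * Y p f)"
    using Rm_on_xi[OF v(2,3) p] by (simp add: fun_eq_iff algebra_simps)
  also have "g p \<dots> (X p) = (\<rho> p * \<eta> Y p) * g p (Z p) (X p) + g p (\<lambda>f. (- \<rho> p * \<eta> Z p) * Y p f) (X p)"
    by (intro g_lincomb t v tangent_scale)
  also have "g p (\<lambda>f. (- \<rho> p * \<eta> Z p) * Y p f) (X p) = (- \<rho> p * \<eta> Z p) * g p (Y p) (X p)"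
    by (intro g_scale t v)
  also have "g p (Z p) (X p) = g p (X p) (Z p)" by (intro g_sym t v)
  also have "g p (Y p) (X p) = g p (X p) (Y p)" by (intro g_sym t v)
  finally show ?thesis by (simp add: algebra_simps)
qed

lemma g_Rm_xi_swap:
  assumes v: "vf X" "vf Y" "vf Z" and p: "p \<in> W"
  shows "g p (Rm X \<xi> Y p) (Z p) = - (g p (Rm \<xi> X Y p) (Z p))"
proof -
  have "Rm X \<xi> Y p = (\<lambda>f. (-1) * Rm \<xi> X Y p f)"
    using Rm_anticommute[OF xi_vf v(1,2) p] by (simp add: fun_eq_iff)
  then show ?thesis using g_scale[OF vf_tangent[OF Rm_vf[OF xi_vf v(1,2)] p] vf_tangent[OF v(3) p], of "-1"] by simp
qed

text \<open>
  This is \<open>g((\<nabla>\<^sub>X P)(Y) Z, V)\<close> for the tensor \<open>P(Y) Z = Rm(\<xi>, Y) Z = \<rho> (\<eta>(Z) Y - g(Y, Z) \<xi>)\<close>: the first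
  summand differentiates the factor \<open>\<rho>\<close>, the second differentiates \<open>\<eta>\<close> and \<open>\<xi>\<close>.
\<close>

definition bianchi_term :: "'m field \<Rightarrow> 'm field \<Rightarrow> 'm field \<Rightarrow> 'm field \<Rightarrow> 'm \<Rightarrow> real" where
  "bianchi_term X Y Z V p = \<rho> p * \<eta> X p * (\<eta> Z p * g p (Y p) (V p) - \<eta> V p * g p (Y p) (Z p))
     + (\<rho> p)\<^sup>2 * (g p (X p) (Z p) * g p (Y p) (V p) - g p (X p) (V p) * g p (Y p) (Z p))"

text \<open>
  Compatibility with \<open>g\<close> moves the derivative of the field \<open>Rm \<xi> Y Z\<close> to the function
  \<open>g(Rm \<xi> Y Z, V)\<close>, which \<open>g_Rm_xi\<close> gives explicitly; then only the product rule and \<open>\<nabla>\<^sub>X \<xi> = \<rho> X\<close> are used.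
\<close>

lemma D_Rm_xi:
  assumes v: "vf X" "vf Y" "vf Z" "vf V" and p: "p \<in> W"
  shows "g p (D X (Rm \<xi> Y Z) p) (V p) - g p (Rm \<xi> Y (D X Z) p) (V p)
      = g p (Rm \<xi> (D X Y) Z p) (V p) + bianchi_term X Y Z V p"
    and "g p (D X (Rm Y \<xi> Z) p) (V p) - g p (Rm Y \<xi> (D X Z) p) (V p)
      = - g p (Rm \<xi> (D X Y) Z p) (V p) - bianchi_term X Y Z V p"
proof -
  let ?i = "\<lambda>P Q q. g q (P q) (Q q)"
  let ?Q = "\<lambda>q. \<rho> q * (\<eta> Z q * ?i Y V q - \<eta> V q * ?i Y Z q)"
  note vI = v D_vf xi_vf
  have dg: "X p (?i P Q) = ?i (D X P) Q p + ?i P (D X Q) p" if "vf P" "vf Q" for P Q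
    by (rule D_metric[OF v(1) that p])
  have gx: "?i P (D X \<xi>) p = \<rho> p * ?i X P p" if "vf P" for P
    using g_D_xi[OF v(1) that p rho_nonzero[OF p]] g_sym[OF vf_tangent[OF that p] vf_tangent[OF D_vf[OF v(1) xi_vf] p]]
    by simp
  have "X p ?Q = \<rho> p * X p (\<lambda>q. \<eta> Z q * ?i Y V q - \<eta> V q * ?i Y Z q) + X p \<rho> * (\<eta> Z p * ?i Y V p - \<eta> V p * ?i Y Z p)"
    by (intro deriv_mult p rho_sm sm_intros vI)
  also have "X p (\<lambda>q. \<eta> Z q * ?i Y V q - \<eta> V q * ?i Y Z q) = X p (\<lambda>q. \<eta> Z q * ?i Y V q) - X p (\<lambda>q. \<eta> V q * ?i Y Z q)"
    by (intro deriv_diff p sm_intros vI)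
  also have "X p (\<lambda>q. \<eta> Z q * ?i Y V q) = \<eta> Z p * X p (?i Y V) + X p (\<eta> Z) * ?i Y V p"
    by (intro deriv_mult p sm_intros vI)
  also have "X p (\<lambda>q. \<eta> V q * ?i Y Z q) = \<eta> V p * X p (?i Y Z) + X p (\<eta> V) * ?i Y Z p"
    by (intro deriv_mult p sm_intros vI)
  finally have Q: "X p ?Q = \<rho> p * ((\<eta> Z p * (?i (D X Y) V p + ?i Y (D X V) p) + (\<eta> (D X Z) p + \<rho> p * ?i X Z p) * ?i Y V p)
      - (\<eta> V p * (?i (D X Y) Z p + ?i Y (D X Z) p) + (\<eta> (D X V) p + \<rho> p * ?i X V p) * ?i Y Z p))
      + \<rho> p * \<eta> X p * (\<eta> Z p * ?i Y V p - \<eta> V p * ?i Y Z p)"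
    unfolding dg[OF v(2,4)] dg[OF v(2,3)] dg[OF v(3) xi_vf] dg[OF v(4) xi_vf] gx[OF v(3)] gx[OF v(4)] d_rho[OF v(1) p] .
  have "X p (?i (Rm \<xi> Y Z) V) = X p ?Q"
    by (rule deriv_cong[OF v(1) p g_Rm_xi[OF v(2,3,4)]])
  moreover have "X p (?i (Rm \<xi> Y Z) V) = ?i (D X (Rm \<xi> Y Z)) V p + ?i (Rm \<xi> Y Z) (D X V) p"
    by (intro dg vI Rm_vf)
  ultimately show A: "g p (D X (Rm \<xi> Y Z) p) (V p) - g p (Rm \<xi> Y (D X Z) p) (V p)
      = g p (Rm \<xi> (D X Y) Z p) (V p) + bianchi_term X Y Z V p"
    using Q g_Rm_xi[OF v(2,3) D_vf[OF v(1,4)] p] g_Rm_xi[OF v(2) D_vf[OF v(1,3)] v(4) p]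
      g_Rm_xi[OF D_vf[OF v(1,2)] v(3,4) p]
    unfolding bianchi_term_def by (simp add: algebra_simps power2_eq_square)
  have "X p (?i (Rm Y \<xi> Z) V) = X p (\<lambda>q. (-1) * ?i (Rm \<xi> Y Z) V q)"
    by (rule deriv_cong[OF v(1) p]) (simp add: g_Rm_xi_swap v)
  also have "\<dots> = (-1) * X p (?i (Rm \<xi> Y Z) V)"
    by (intro deriv_cmult p sm_intros vI Rm_vf)
  finally show "g p (D X (Rm Y \<xi> Z) p) (V p) - g p (Rm Y \<xi> (D X Z) p) (V p)
      = - g p (Rm \<xi> (D X Y) Z p) (V p) - bianchi_term X Y Z V p"
    using A dg[OF Rm_vf[OF v(2) xi_vf v(3)] v(4)] dg[OF Rm_vf[OF xi_vf v(2) v(3)] v(4)]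
      g_Rm_xi_swap[OF v(2,3) D_vf[OF v(1,4)] p] g_Rm_xi_swap[OF v(2) D_vf[OF v(1,3)] v(4) p]
    by simp
qed

text \<open>
  The second Bianchi identity for \<open>\<xi>\<close>, \<open>X\<close>, \<open>Y\<close>, where the derivatives along \<open>X\<close> and \<open>Y\<close> only meet
  curvature components with an entry \<open>\<xi>\<close>.  The summand \<open>-2 \<rho> Rm\<close> comes from the brackets
  \<open>[\<xi>, X] = \<nabla>\<^sub>\<xi> X - \<rho> X\<close> and \<open>[\<xi>, Y] = \<nabla>\<^sub>\<xi> Y - \<rho> Y\<close>.
\<close>

lemma xi_Rm:
  assumes v: "vf X" "vf Y" "vf Z" "vf V" and p: "p \<in> W"
  shows "\<xi> p (\<lambda>q. g q (Rm X Y Z q) (V q)) =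
    g p (Rm (D \<xi> X) Y Z p) (V p) + g p (Rm X (D \<xi> Y) Z p) (V p) + g p (Rm X Y (D \<xi> Z) p) (V p)
    + g p (Rm X Y Z p) (D \<xi> V p) - 2 * \<rho> p * g p (Rm X Y Z p) (V p) + bianchi_term X Y Z V p - bianchi_term Y X Z V p"
proof -
  let ?i = "\<lambda>P q. g q (P q) (V q)"
  note vI = v D_vf xi_vf Rm_vf bracket_vf
  note t = vf_tangent[OF _ p]
  have bx: "br \<xi> P q = (\<lambda>q f. (- \<rho> q) * P q f + D \<xi> P q f) q"
    "br P \<xi> q = (\<lambda>q f. \<rho> q * P q f + (-1) * D \<xi> P q f) q" if "vf P" "q \<in> W" for P q
    using D_torsion[OF xi_vf that] D_torsion[OF that(1) xi_vf that(2)] D_xi[OF that]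
    by (simp_all add: fun_eq_iff)
  have e1: "Rm (br \<xi> X) Y Z p f = - \<rho> p * Rm X Y Z p f + Rm (D \<xi> X) Y Z p f" for f
  proof -
    have "Rm (br \<xi> X) Y Z p f = Rm (\<lambda>q f. (- \<rho> q) * X q f + D \<xi> X q f) Y Z p f"
      by (rule fun_cong[OF Rm_cong[OF bracket_vf[OF xi_vf v(1)] v(2,3) bx(1)[OF v(1)] refl refl p]])
    also have "\<dots> = - \<rho> p * Rm X Y Z p f + Rm (D \<xi> X) Y Z p f"
      by (intro Rm_lincomb_left vI p smooth_fun_minus[OF W] rho_sm)
    finally show ?thesis .
  qed
  have e2: "Rm (br Y \<xi>) X Z p f = - \<rho> p * Rm X Y Z p f + Rm X (D \<xi> Y) Z p f" for f
  proof -
    have "Rm (br Y \<xi>) X Z p f = Rm (\<lambda>q f. \<rho> q * Y q f + (-1) * D \<xi> Y q f) X Z p f"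
      by (rule fun_cong[OF Rm_cong[OF bracket_vf[OF v(2) xi_vf] v(1,3) bx(2)[OF v(2)] refl refl p]])
    also have "\<dots> = \<rho> p * Rm Y X Z p f + Rm (\<lambda>q f. (-1) * D \<xi> Y q f) X Z p f"
      by (intro Rm_lincomb_left vI p vf_intros smooth_fun_const rho_sm)
    also have "Rm (\<lambda>q f. (-1) * D \<xi> Y q f) X Z p f = (-1) * Rm (D \<xi> Y) X Z p f"
      using Rm_lincomb_left[OF D_vf[OF xi_vf v(2)] vector_field_zero v(1,3) smooth_fun_const p, of "-1" f]
        Rm_zero(1)[OF v(1,3) p] by simp
    finally show ?thesis
      using Rm_anticommute[OF v(1,2,3) p, of f] Rm_anticommute[OF v(1) D_vf[OF xi_vf v(2)] v(3) p, of f] by simp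
  qed
  have e3: "Rm (br X Y) \<xi> Z p f = Rm \<xi> (D Y X) Z p f - Rm \<xi> (D X Y) Z p f" for f
  proof -
    have "Rm (br X Y) \<xi> Z p f = - Rm \<xi> (br X Y) Z p f"
      by (rule Rm_anticommute[OF xi_vf bracket_vf[OF v(1,2)] v(3) p])
    also have "Rm \<xi> (br X Y) Z p f = Rm \<xi> (\<lambda>q f. (-1) * D Y X q f + D X Y q f) Z p f"
      by (rule fun_cong[OF Rm_cong[OF xi_vf bracket_vf[OF v(1,2)] v(3) refl _ refl p]])
        (simp add: fun_eq_iff D_torsion v)
    also have "\<dots> = (-1) * Rm \<xi> (D Y X) Z p f + Rm \<xi> (D X Y) Z p f"
      by (intro Rm_lincomb_middle vI p smooth_fun_const)
    finally show ?thesis by simp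
  qed
  have "D \<xi> (Rm X Y Z) p = (\<lambda>f. Rm X Y (D \<xi> Z) p f
      - (D X (Rm Y \<xi> Z) p f - Rm Y \<xi> (D X Z) p f) - (D Y (Rm \<xi> X Z) p f - Rm \<xi> X (D Y Z) p f)
      + (Rm (D \<xi> X) Y Z p f - (2 * \<rho> p) * Rm X Y Z p f) + (Rm \<xi> (D Y X) Z p f - Rm \<xi> (D X Y) Z p f)
      + Rm X (D \<xi> Y) Z p f)"
  proof
    fix f
    show "D \<xi> (Rm X Y Z) p f = Rm X Y (D \<xi> Z) p f
      - (D X (Rm Y \<xi> Z) p f - Rm Y \<xi> (D X Z) p f) - (D Y (Rm \<xi> X Z) p f - Rm \<xi> X (D Y Z) p f)
      + (Rm (D \<xi> X) Y Z p f - (2 * \<rho> p) * Rm X Y Z p f) + (Rm \<xi> (D Y X) Z p f - Rm \<xi> (D X Y) Z p f)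
      + Rm X (D \<xi> Y) Z p f"
      using Rm_bianchi2[OF xi_vf v(1,2,3) p, of f] unfolding e1 e2 e3 by simp
  qed
  then have "?i (D \<xi> (Rm X Y Z)) p = ?i (Rm X Y (D \<xi> Z)) p
      - (?i (D X (Rm Y \<xi> Z)) p - ?i (Rm Y \<xi> (D X Z)) p) - (?i (D Y (Rm \<xi> X Z)) p - ?i (Rm \<xi> X (D Y Z)) p)
      + (?i (Rm (D \<xi> X) Y Z) p - (2 * \<rho> p) * ?i (Rm X Y Z) p) + (?i (Rm \<xi> (D Y X) Z) p - ?i (Rm \<xi> (D X Y) Z) p)
      + ?i (Rm X (D \<xi> Y) Z) p"
    by (simp only: g_add g_diff g_scale tangent_plus tangent_minus tangent_scale t vI)
  then show ?thesis
    using D_metric[OF xi_vf Rm_vf[OF v(1,2,3)] v(4) p] D_Rm_xi(2)[OF v p] D_Rm_xi(1)[OF v(2,1,3,4) p]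
    by simp
qed

text \<open>
  The trace of \<open>xi_Rm\<close> over an orthonormal frame.  The derivatives of the frame drop out (\<open>T1\<close>, \<open>T2\<close>),
  since \<open>g(\<nabla>\<^sub>\<xi> B\<^sub>i, B\<^sub>k)\<close> is skew-symmetric in \<open>i\<close> and \<open>k\<close>; comparing the outcome with
  \<open>\<xi> R = \<rho> |\<xi>|\<^sup>2\<close> and dividing by \<open>2 \<rho> n\<close> leaves a relation that is linear in \<open>\<rho>\<close>.
\<close>

lemma scalar_identity:
  assumes p: "p \<in> W"
  shows "2 * (\<rho> p + l) = (1 - real CARD('n)) * \<rho> p"
proof -
  let ?N = "real CARD('n)"
  define S where "S = scalar_curvature A g D"
  let ?R = "\<lambda>i j q. g q (Rm (B i) (B j) (B j) q) (B i q)"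
  define a where "a = (\<lambda>i k. g p (D \<xi> (B i) p) (B k p))"
  note t = vf_tangent[OF _ p]
  have skew: "a i k = - a k i" for i k
  proof -
    have "\<xi> p (\<lambda>q. g q (B i q) (B k q)) = \<xi> p (\<lambda>q. if i = k then 1 else 0)"
      by (rule deriv_cong[OF xi_vf p B_orthonormal])
    then show ?thesis
      using D_metric[OF xi_vf B_vf B_vf p, of i k] deriv_const[OF xi_vf p]
        g_sym[OF t[OF B_vf] t[OF D_vf[OF xi_vf B_vf]], of i k] by (simp add: a_def)
  qed
  define h where "h = (\<lambda>i. \<eta> (B i) p)"
  have h: "(\<Sum>i\<in>UNIV. h i * h i) = \<eta> \<xi> p"
    using g_expand[OF p t[OF xi_vf] t[OF xi_vf]] g_sym[OF t[OF B_vf] t[OF xi_vf]] by (simp add: h_def)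
  have Rs: "sm (?R i j)" for i j by (intro g_smooth[OF W] Rm_vf B_vf)
  have T1: "(\<Sum>j\<in>UNIV. \<Sum>i\<in>UNIV.
      g p (Rm (D \<xi> (B i)) (B j) (B j) p) (B i p) + g p (Rm (B i) (B j) (B j) p) (D \<xi> (B i) p)) = 0"
  proof (rule sum.neutral, rule ballI)
    fix j
    have "g p (Rm (D \<xi> (B i)) (B j) (B j) p) (B i p) + g p (Rm (B i) (B j) (B j) p) (D \<xi> (B i) p)
      = (\<Sum>k\<in>UNIV. a i k * (g p (Rm (B k) (B j) (B j) p) (B i p) + g p (Rm (B i) (B j) (B j) p) (B k p)))" for i
      using Rm_expand(1)[OF D_vf[OF xi_vf B_vf] B_vf B_vf B_vf p, of i j j i]
        Rm_expand(4)[OF B_vf B_vf B_vf D_vf[OF xi_vf B_vf] p, of i j j i]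
      by (simp add: a_def sum.distrib[symmetric] distrib_left)
    then show "(\<Sum>i\<in>UNIV. g p (Rm (D \<xi> (B i)) (B j) (B j) p) (B i p) + g p (Rm (B i) (B j) (B j) p) (D \<xi> (B i) p)) = 0"
      using skew_sum[of a "\<lambda>k i. g p (Rm (B k) (B j) (B j) p) (B i p)" UNIV, OF skew] by simp
  qed
  have T2: "(\<Sum>j\<in>UNIV. \<Sum>i\<in>UNIV.
      g p (Rm (B i) (D \<xi> (B j)) (B j) p) (B i p) + g p (Rm (B i) (B j) (D \<xi> (B j)) p) (B i p)) = 0"
  proof (subst sum.swap, rule sum.neutral, rule ballI)
    fix i
    have "g p (Rm (B i) (D \<xi> (B j)) (B j) p) (B i p) + g p (Rm (B i) (B j) (D \<xi> (B j)) p) (B i p)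
      = (\<Sum>k\<in>UNIV. a j k * (g p (Rm (B i) (B k) (B j) p) (B i p) + g p (Rm (B i) (B j) (B k) p) (B i p)))" for j
      using Rm_expand(2)[OF B_vf D_vf[OF xi_vf B_vf] B_vf B_vf p, of i j j i]
        Rm_expand(3)[OF B_vf B_vf D_vf[OF xi_vf B_vf] B_vf p, of i j j i]
      by (simp add: a_def sum.distrib[symmetric] distrib_left)
    then show "(\<Sum>j\<in>UNIV. g p (Rm (B i) (D \<xi> (B j)) (B j) p) (B i p) + g p (Rm (B i) (B j) (D \<xi> (B j)) p) (B i p)) = 0"
      using skew_sum[of a "\<lambda>k j. g p (Rm (B i) (B k) (B j) p) (B i p)" UNIV, OF skew] by simp
  qed
  have T3: "(\<Sum>j\<in>UNIV. \<Sum>i\<in>UNIV. ?R i j p) = S p"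
    unfolding S_def by (rule scalar_curvature_frame[OF p, symmetric])
  have T4: "(\<Sum>j\<in>UNIV. \<Sum>i\<in>UNIV. bianchi_term (B i) (B j) (B j) (B i) p - bianchi_term (B j) (B i) (B j) (B i) p)
      = 2 * \<rho> p * (1 - ?N) * \<eta> \<xi> p + 2 * (\<rho> p)\<^sup>2 * ?N * (1 - ?N)"
  proof -
    have "bianchi_term (B i) (B j) (B j) (B i) p - bianchi_term (B j) (B i) (B j) (B i) p
       = (if i = j then 2 * \<rho> p * (h i * h i) + 2 * (\<rho> p)\<^sup>2 else 0)
         - \<rho> p * (h i * h i) - \<rho> p * (h j * h j) - 2 * (\<rho> p)\<^sup>2" for i j
      unfolding bianchi_term_def B_orthonormal[OF p] h_def by (simp add: algebra_simps)
    then have "(\<Sum>j\<in>UNIV. \<Sum>i\<in>UNIV. bianchi_term (B i) (B j) (B j) (B i) p - bianchi_term (B j) (B i) (B j) (B i) p)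
       = (\<Sum>j\<in>UNIV. (2 * \<rho> p * (h j * h j) + 2 * (\<rho> p)\<^sup>2) - \<rho> p * \<eta> \<xi> p - ?N * (\<rho> p * (h j * h j)) - ?N * (2 * (\<rho> p)\<^sup>2))"
      by (simp add: sum.distrib sum_subtractf sum_distrib_left[symmetric] h)
    also have "\<dots> = 2 * \<rho> p * \<eta> \<xi> p + ?N * (2 * (\<rho> p)\<^sup>2) - ?N * (\<rho> p * \<eta> \<xi> p) - ?N * (\<rho> p * \<eta> \<xi> p) - ?N * (?N * (2 * (\<rho> p)\<^sup>2))"
      by (simp add: sum.distrib sum_subtractf sum_distrib_left[symmetric] h)
    finally show ?thesis by (simp add: algebra_simps power2_eq_square)
  qed
  have "\<xi> p S = \<xi> p (\<lambda>q. \<Sum>j\<in>UNIV. \<Sum>i\<in>UNIV. ?R i j q)"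
    unfolding S_def by (rule deriv_cong[OF xi_vf p scalar_curvature_frame])
  also have "\<dots> = (\<Sum>j\<in>UNIV. \<Sum>i\<in>UNIV. \<xi> p (?R i j))"
    using deriv_sum[OF xi_vf p, of UNIV] Rs by (simp add: deriv_sum[OF xi_vf p])
  also have "\<dots> = (\<Sum>j\<in>UNIV. \<Sum>i\<in>UNIV.
      (g p (Rm (D \<xi> (B i)) (B j) (B j) p) (B i p) + g p (Rm (B i) (B j) (B j) p) (D \<xi> (B i) p))
    + (g p (Rm (B i) (D \<xi> (B j)) (B j) p) (B i p) + g p (Rm (B i) (B j) (D \<xi> (B j)) p) (B i p))
    - 2 * \<rho> p * ?R i j p
    + (bianchi_term (B i) (B j) (B j) (B i) p - bianchi_term (B j) (B i) (B j) (B i) p))"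
    by (intro sum.cong refl) (simp add: xi_Rm p)
  also have "\<dots> = (\<Sum>j\<in>UNIV. \<Sum>i\<in>UNIV.
      g p (Rm (D \<xi> (B i)) (B j) (B j) p) (B i p) + g p (Rm (B i) (B j) (B j) p) (D \<xi> (B i) p))
    + (\<Sum>j\<in>UNIV. \<Sum>i\<in>UNIV.
      g p (Rm (B i) (D \<xi> (B j)) (B j) p) (B i p) + g p (Rm (B i) (B j) (D \<xi> (B j)) p) (B i p))
    - 2 * \<rho> p * (\<Sum>j\<in>UNIV. \<Sum>i\<in>UNIV. ?R i j p)
    + (\<Sum>j\<in>UNIV. \<Sum>i\<in>UNIV. bianchi_term (B i) (B j) (B j) (B i) p - bianchi_term (B j) (B i) (B j) (B i) p)"
    by (simp only: sum.distrib sum_subtractf sum_distrib_left)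
  also have "\<dots> = 0 + 0 - 2 * \<rho> p * S p + (2 * \<rho> p * (1 - ?N) * \<eta> \<xi> p + 2 * (\<rho> p)\<^sup>2 * ?N * (1 - ?N))"
    unfolding T1 T2 T3 T4 ..
  finally have 1: "\<xi> p S = - 2 * \<rho> p * S p + 2 * \<rho> p * (1 - ?N) * \<eta> \<xi> p + 2 * (\<rho> p)\<^sup>2 * ?N * (1 - ?N)"
    by simp
  have "\<xi> p S = \<xi> p (\<lambda>q. \<rho> q + l)" by (simp add: S_def \<rho>_def)
  also have "\<dots> = \<xi> p \<rho>"
    using deriv_add[OF xi_vf p rho_sm smooth_fun_const, of l] deriv_const[OF xi_vf p] by simp
  finally have "\<rho> p * (2 * (\<rho> p + l)) = - 2 * \<rho> p * (\<rho> p + l) + 2 * \<rho> p * (1 - ?N) * (2 * (\<rho> p + l)) + 2 * (\<rho> p)\<^sup>2 * ?N * (1 - ?N)"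
    using 1 xi_rho[OF p] by (simp add: eta_xi S_def \<rho>_def)
  then have "(2 * \<rho> p * ?N) * (2 * (\<rho> p + l) - (1 - ?N) * \<rho> p) = 0"
    by (simp add: algebra_simps power2_eq_square)
  then show ?thesis using rho_nonzero[OF p] by simp
qed

end

section \<open>Constancy of the scalar curvature\<close>

lemma (in smooth_manifold) smooth_fun_continuous:
  assumes c: "(U, c) \<in> A" and f: "smooth_fun A U f"
  shows "continuous_on U f"
proof -
  have "smooth_on (c ` U) (f \<circ> inv_into U c)" using f c unfolding smooth_fun_def by fastforce
  then have "continuous_on (c ` U) (f \<circ> inv_into U c)"
    unfolding smooth_on_def by (metis Ck_on.simps(1))
  moreover have "continuous_on U c"
    using atlas c unfolding smooth_atlas_def homeomorphism_def by fast
  ultimately have "continuous_on U ((f \<circ> inv_into U c) \<circ> c)"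
    by (rule continuous_on_compose[rotated])
  then show ?thesis by (rule continuous_on_eq) (simp add: chart_inv[OF c])
qed

lemma (in yamabe) rho_vanishes: "\<rho> p = 0"
proof (rule ccontr)
  assume nz: "\<rho> p \<noteq> 0"
  obtain U c where c: "(U, c) \<in> A" "p \<in> U" using chart_at .
  interpret U: yamabe_local A g D \<xi> l \<phi> U
    by unfold_locales (rule chart_open[OF c(1)])
  obtain B where B: "orthonormal_frame U B" using orthonormal_frame_exists[OF c(1)] by blast
  define W where "W = U \<inter> \<rho> -` (- {0})"
  have "open W"
    unfolding W_def using smooth_fun_continuous[OF c(1) U.rho_sm] chart_open[OF c(1)]
    by (intro continuous_open_preimage) auto
  then interpret W: yamabe_framed A g D \<xi> l \<phi> W B
    by unfold_locales (auto simp: W_def intro: orthonormal_frame_subset[OF B])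
  have p: "p \<in> W" using c nz by (simp add: W_def)
  \<comment> \<open>by the linear relation, \<open>\<rho>\<close> would be constant on \<open>W\<close>, whereas \<open>\<xi> \<rho> = \<rho> |\<xi>|\<^sup>2\<close> is nonzero there\<close>
  have "\<rho> q = - 2 * l / (1 + real CARD('n))" if "q \<in> W" for q
    using W.scalar_identity[OF that] by (simp add: field_simps)
  then have "\<xi> p \<rho> = \<xi> p (\<lambda>q. - 2 * l / (1 + real CARD('n)))"
    by (rule W.deriv_cong[OF W.xi_vf p])
  then have "\<rho> p * \<eta> \<xi> p = 0"
    using W.xi_rho[OF p] W.deriv_const[OF W.xi_vf p] by simp
  then show False using nz eta_xi_pos[of p] by simp
qed

theorem theorem3p4:
  fixes A :: "('m::{t2_space,second_countable_topology}, 'n::finite) chart set"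
    and g :: "'m \<Rightarrow> 'm tangent \<Rightarrow> 'm tangent \<Rightarrow> real"
    and D :: "'m field \<Rightarrow> 'm field \<Rightarrow> 'm field"
    and \<xi> :: "'m field"
    and l :: real
    and \<phi> :: "'m \<Rightarrow> 'm tangent \<Rightarrow> 'm tangent"
  assumes "yamabe_soliton A g D \<xi> l"
    and "\<And>p. scalar_curvature A g D p > 0"
    and "associated_tensor A g \<xi> \<phi>"
    and "phi_analytic A \<xi> \<phi>"
    and "\<And>p. sqrt (g p (\<xi> p) (\<xi> p)) = sqrt (2 * scalar_curvature A g D p)"
  shows "yamabe_metric A g D"
proof -
  interpret yamabe A g D \<xi> l \<phi>
    by unfold_locales (use assms in \<open>auto simp: yamabe_soliton_def\<close>)
  have "scalar_curvature A g D p = l" for p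
    using rho_vanishes[of p] by (simp add: \<rho>_def)
  then show ?thesis unfolding yamabe_metric_def by blast
qed

end
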